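(* If $r$ divides the inseparable degree $[K:F]_{\rm i}$, then $\mathscr{D}(K,r,\pi)$ is nonempty for every monic irreducible $\pi\in A$.
   Context: Let $p$ be a prime, $q$ a power of $p$, $A=\mathbb{F}_q[t]$, $F=\mathbb{F}_q(t)$. $K$ is a finite extension of $F$, $K_{\rm s}$ the separable closure of $F$ in $K$, $[K:F]_{\rm i}=[K:K_{\rm s}]$, and $r$ a positive integer. For a monic irreducible $\pi\in A$ let $\mathbb{F}_\pi=A/\pi A$, $q_\pi=\#\mathbb{F}_\pi$. $K\{\tau\}$ is the twisted polynomial ring with $\tau c=c^q\tau$. A Drinfeld module of rank $r$ over $K$ is an $\mathbb{F}_q$-algebra homomorphism $\phi:A\to K\{\tau\}$ with $\phi_t=t+c_1\tau+\cdots+c_r\tau^r$, $c_r\ne0$; isomorphisms over $L\supseteq K$ are $\psi_a=c\phi_ac^{-1}$, $c\in L^\times$. $\phi[\pi]=\{\lambda\in K^{\rm sep}:\phi_\pi(\lambda)=0\}$ is an $r$-dimensional $\mathbb{F}_\pi$-vector space with $G_K$-action, giving $\bar\rho_{\phi,\pi}:G_K\to\mathrm{GL}_r(\mathbb{F}_\pi)$. $\phi$ has good reduction at a finite place $v$ if it is isomorphic over $K_v$ to some $\psi$ with $\psi_t=t+\sum c_i'\tau^i$, $c_i'\in\mathcal{O}_{K_v}$, $c_r'\in\mathcal{O}_{K_v}^\times$. The Carlitz module is $\mathcal{C}_t=t+\tau$ and $\chi_\pi:G_F\to\mathrm{Aut}(\mathcal{C}[\pi])=\mathbb{F}_\pi^\times$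 is the mod $\pi$ Carlitz character. $\mathscr{D}(K,r,\pi)$ is the set of $K$-isomorphism classes of rank-$r$ Drinfeld modules $\phi$ over $K$ such that (D1) $\phi$ has good reduction at every finite place of $K$ not above $\pi$, and (D2) $\bar\rho_{\phi,\pi}$ is isomorphic to an upper triangular representation with diagonal characters $\chi_\pi^{i_1},\dots,\chi_\pi^{i_r}$, $0\le i_s\le q_\pi-1$. *)

theory Defs
  imports "HOL-Computational_Algebra.Computational_Algebra"
begin

(* Ambient setting: a type 'a which is an algebraically closed field of
   characteristic p.  All fields (F_q, F = F_q(t), K, K^sep, ...) are subsets. *)

definition alg_closed :: "'a::field itself \<Rightarrow> bool" where
  "alg_closed (_::'a itself) \<longleftrightarrow> (\<forall>f::'a poly. 0 < degree f \<longrightarrow> (\<exists>x. poly f x = 0))"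

definition Fq :: "nat \<Rightarrow> 'a::field set" where
  "Fq q = {x. x ^ q = x}"

definition polyA :: "nat \<Rightarrow> 'a::field poly set" where
  "polyA q = {a. set (coeffs a) \<subseteq> Fq q}"

definition transcendental_over_Fq :: "nat \<Rightarrow> 'a::field \<Rightarrow> bool" where
  "transcendental_over_Fq q t \<longleftrightarrow> (\<forall>a\<in>polyA q. a \<noteq> 0 \<longrightarrow> poly a t \<noteq> 0)"

definition ratfield :: "nat \<Rightarrow> 'a::field \<Rightarrow> 'a set" where
  "ratfield q t = {poly a t / poly b t | a b. a \<in> polyA q \<and> b \<in> polyA q \<and> poly b t \<noteq> 0}"

definition monic_irreducible_A :: "nat \<Rightarrow> 'a::field poly \<Rightarrow> bool" where
  "monic_irreducible_A q \<pi> \<longleftrightarrow> \<pi> \<in> polyA q \<and> lead_coeff \<pi> = 1 \<and> 0 < degree \<pi> \<and>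
     (\<forall>a\<in>polyA q. \<forall>b\<in>polyA q. \<pi> = a * b \<longrightarrow> degree a = 0 \<or> degree b = 0)"

(* q_pi = #(A / pi A) *)
definition q_pi :: "nat \<Rightarrow> 'a::field poly \<Rightarrow> nat" where
  "q_pi q \<pi> = q ^ degree \<pi>"

definition is_subfield :: "'a::field set \<Rightarrow> bool" where
  "is_subfield S \<longleftrightarrow> 0 \<in> S \<and> 1 \<in> S \<and> (\<forall>x\<in>S. \<forall>y\<in>S. x + y \<in> S \<and> x - y \<in> S \<and> x * y \<in> S)
     \<and> (\<forall>x\<in>S. x \<noteq> 0 \<longrightarrow> inverse x \<in> S)"

definition span_over :: "'a::field set \<Rightarrow> 'a list \<Rightarrow> 'a set" where
  "span_over S xs = {\<Sum>i<length xs. c i * xs ! i | c. \<forall>i<length xs. c i \<in> S}"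

definition findim_over :: "'a::field set \<Rightarrow> 'a set \<Rightarrow> bool" where
  "findim_over S E \<longleftrightarrow> (\<exists>xs. set xs \<subseteq> E \<and> span_over S xs = E)"

definition degree_over :: "'a::field set \<Rightarrow> 'a set \<Rightarrow> nat" where
  "degree_over S E = (LEAST n. \<exists>xs. length xs = n \<and> set xs \<subseteq> E \<and> span_over S xs = E)"

definition separable_over :: "'a::field set \<Rightarrow> 'a \<Rightarrow> bool" where
  "separable_over S x \<longleftrightarrow> (\<exists>f. f \<noteq> 0 \<and> set (coeffs f) \<subseteq> S \<and> poly f x = 0 \<and> coprime f (pderiv f))"

definition sep_closure_in :: "'a::field set \<Rightarrow> 'a set \<Rightarrow> 'a set" where
  "sep_closure_in S E = {x\<in>E. separable_over S x}"

definition sep_closure :: "'a::field set \<Rightarrow> 'a set" where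
  "sep_closure S = {x. separable_over S x}"

definition insep_degree :: "nat \<Rightarrow> 'a::field \<Rightarrow> 'a set \<Rightarrow> nat" where
  "insep_degree q t K = degree_over (sep_closure_in (ratfield q t) K) K"

definition abs_galois :: "'a::field set \<Rightarrow> ('a \<Rightarrow> 'a) set" where
  "abs_galois S = {\<sigma>. bij_betw \<sigma> (sep_closure S) (sep_closure S) \<and>
      (\<forall>x\<in>sep_closure S. \<forall>y\<in>sep_closure S. \<sigma> (x + y) = \<sigma> x + \<sigma> y \<and> \<sigma> (x * y) = \<sigma> x * \<sigma> y) \<and>
      (\<forall>x\<in>S. \<sigma> x = x)}"

(* A Drinfeld module of rank r is determined by phi_t = c 0 + c 1 tau + ... + c r tau^r;
   twisted polynomials act on the ambient field via tau x = x^q. *)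
definition phi_t :: "nat \<Rightarrow> nat \<Rightarrow> (nat \<Rightarrow> 'a::field) \<Rightarrow> 'a \<Rightarrow> 'a" where
  "phi_t q r c x = (\<Sum>i\<le>r. c i * x ^ (q ^ i))"

definition phi_act :: "nat \<Rightarrow> nat \<Rightarrow> (nat \<Rightarrow> 'a::field) \<Rightarrow> 'a poly \<Rightarrow> 'a \<Rightarrow> 'a" where
  "phi_act q r c a x = (\<Sum>j\<le>degree a. coeff a j * ((phi_t q r c) ^^ j) x)"

definition drinfeld_module :: "nat \<Rightarrow> 'a::field \<Rightarrow> 'a set \<Rightarrow> nat \<Rightarrow> (nat \<Rightarrow> 'a) \<Rightarrow> bool" where
  "drinfeld_module q t K r c \<longleftrightarrow> c 0 = t \<and> (\<forall>i\<le>r. c i \<in> K) \<and> c r \<noteq> 0"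

definition carlitz_act :: "nat \<Rightarrow> 'a::field \<Rightarrow> 'a poly \<Rightarrow> 'a \<Rightarrow> 'a" where
  "carlitz_act q t a x = phi_act q 1 (\<lambda>i. if i = 0 then t else 1) a x"

definition dm_torsion :: "nat \<Rightarrow> 'a::field set \<Rightarrow> nat \<Rightarrow> (nat \<Rightarrow> 'a) \<Rightarrow> 'a poly \<Rightarrow> 'a set" where
  "dm_torsion q K r c \<pi> = {y\<in>sep_closure K. phi_act q r c \<pi> y = 0}"

definition carlitz_torsion :: "nat \<Rightarrow> 'a::field \<Rightarrow> 'a poly \<Rightarrow> 'a set" where
  "carlitz_torsion q t \<pi> = {y\<in>sep_closure (ratfield q t). carlitz_act q t \<pi> y = 0}"

(* b in A represents chi_pi(sigma) in F_pi^x = (A/pi)^x *)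
definition carlitz_char_rep :: "nat \<Rightarrow> 'a::field \<Rightarrow> 'a poly \<Rightarrow> ('a \<Rightarrow> 'a) \<Rightarrow> 'a poly \<Rightarrow> bool" where
  "carlitz_char_rep q t \<pi> \<sigma> b \<longleftrightarrow> b \<in> polyA q \<and> (\<forall>y\<in>carlitz_torsion q t \<pi>. \<sigma> y = carlitz_act q t b y)"

(* normalized discrete valuations of K (= finite and infinite places of K) *)
definition normalized_dval :: "'a::field set \<Rightarrow> ('a \<Rightarrow> int) \<Rightarrow> bool" where
  "normalized_dval K v \<longleftrightarrow>
     (\<forall>x\<in>K - {0}. \<forall>y\<in>K - {0}. v (x * y) = v x + v y \<and> (x + y \<noteq> 0 \<longrightarrow> min (v x) (v y) \<le> v (x + y)))
     \<and> (\<forall>n. \<exists>x\<in>K - {0}. v x = n)"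

(* good reduction at v: conjugating by u gives psi_t = t + sum (u c_i u^(-q^i)) tau^i with
   integral coefficients and unit leading coefficient *)
definition good_reduction_at :: "nat \<Rightarrow> 'a::field set \<Rightarrow> nat \<Rightarrow> (nat \<Rightarrow> 'a) \<Rightarrow> ('a \<Rightarrow> int) \<Rightarrow> bool" where
  "good_reduction_at q K r c v \<longleftrightarrow> (\<exists>u\<in>K. u \<noteq> 0 \<and>
     (\<forall>i\<in>{1..r}. u * c i / u ^ (q ^ i) = 0 \<or> 0 \<le> v (u * c i / u ^ (q ^ i))) \<and>
     v (u * c r / u ^ (q ^ r)) = 0)"

(* (D1) good reduction at all finite places not above pi *)
definition cond_D1 :: "nat \<Rightarrow> 'a::field \<Rightarrow> 'a set \<Rightarrow> nat \<Rightarrow> (nat \<Rightarrow> 'a) \<Rightarrow> 'a poly \<Rightarrow> bool" where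
  "cond_D1 q t K r c \<pi> \<longleftrightarrow> (\<forall>v. normalized_dval K v \<and> 0 \<le> v t \<and> \<not> 0 < v (poly \<pi> t)
        \<longrightarrow> good_reduction_at q K r c v)"

(* (D2) the mod pi representation is upper triangular with diagonal chi_pi^(i_s):
   there is a full flag 0 = V_0 < V_1 < ... < V_r = phi[pi] of G_K-stable F_pi-subspaces
   with G_K acting on V_s / V_(s-1) via chi_pi^(i_s). *)
definition cond_D2 :: "nat \<Rightarrow> 'a::field \<Rightarrow> 'a set \<Rightarrow> nat \<Rightarrow> (nat \<Rightarrow> 'a) \<Rightarrow> 'a poly \<Rightarrow> bool" where
  "cond_D2 q t K r c \<pi> \<longleftrightarrow> (\<exists>V :: nat \<Rightarrow> 'a set. \<exists>ii :: nat \<Rightarrow> nat.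
      V 0 = {0} \<and> V r = dm_torsion q K r c \<pi> \<and>
      (\<forall>s\<in>{1..r}. V (s - 1) \<subseteq> V s) \<and>
      (\<forall>s\<le>r. 0 \<in> V s \<and> (\<forall>x\<in>V s. \<forall>y\<in>V s. x + y \<in> V s) \<and>
               (\<forall>a\<in>polyA q. \<forall>x\<in>V s. phi_act q r c a x \<in> V s) \<and>
               card (V s) = q_pi q \<pi> ^ s \<and>
               (\<forall>\<sigma>\<in>abs_galois K. \<sigma> ` V s \<subseteq> V s)) \<and>
      (\<forall>s\<in>{1..r}. ii s \<le> q_pi q \<pi> - 1 \<and>
         (\<forall>\<sigma>\<in>abs_galois K. \<exists>b. carlitz_char_rep q t \<pi> \<sigma> b \<and>
             (\<forall>x\<in>V s. \<sigma> x - phi_act q r c (b ^ ii s) x \<in> V (s - 1)))))"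

end

theory Submission
  imports Defs "HOL-Number_Theory.Cong"
begin

text \<open>Let m be maximal such that t has a p^m-th root in K. Then the separable closure of F in K is
  the field of p^m-th powers of elements of K, and the powers of that root show [K : F]_i = p^m. So r is
  a power of p and K contains \<theta> with \<theta>^r = t. The module is \<phi>_t = (\<theta> + \<tau>)^r: it
  is monic with coefficients in F_q[\<theta>], hence has good reduction at every finite place. Since
  \<phi>_a(y)^r = C_{a^r}(y^r), where C is the Carlitz module, the flag of the y with C_{\<pi>^s}(y^r) = 0 has all
  graded pieces isomorphic to C[\<pi>] up to a Frobenius twist, and i with r i = 1 modulo q_\<pi> - 1 undoes
  the twist.\<close>

section \<open>Polynomials and linear algebra over a subfield\<close>

text \<open>When \<theta>^r = t and r is a power of p, the map y \<mapsto> y^r is additive and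
  (\<theta> y + y^q)^r = t y^r + (y^r)^q. So r-th powers carry the r-fold composite of \<theta> +
  \<tau> to that of C_t, which is C_{t^r}. This is the origin of the exponent in a^r, and it makes
  the layers C[\<pi>^s], s \<le> r, exhaust \<phi>[\<pi>]. The twist of scalars can be undone
  because a power of p is prime to q_\<pi> - 1. The module does not depend on \<pi>, so one module
  serves all \<pi>. Two obstacles shape the rest. About K only a degree is known, and roots of t
  have to be extracted from it. This works because F_q is perfect: t alone is a p-basis of F, so all
  inseparability of K over F comes from roots of t. Secondly, a Galois element is a ring map on the
  separable closure only, so applying it to \<phi>_a(y) requires that polynomial expressions over K
  in a separable element are again separable.\<close>

definition over :: "'a::field set \<Rightarrow> 'a poly set" where
  "over S = {f. \<forall>n. coeff f n \<in> S}"

lemma is_subfieldD: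
  assumes "is_subfield S"
  shows "0 \<in> S" "1 \<in> S" "x \<in> S \<Longrightarrow> y \<in> S \<Longrightarrow> x + y \<in> S" "x \<in> S \<Longrightarrow> y \<in> S \<Longrightarrow> x - y \<in> S"
    "x \<in> S \<Longrightarrow> y \<in> S \<Longrightarrow> x * y \<in> S" "x \<in> S \<Longrightarrow> inverse x \<in> S"
    "x \<in> S \<Longrightarrow> y \<in> S \<Longrightarrow> x / y \<in> S" "x \<in> S \<Longrightarrow> - x \<in> S" "x \<in> S \<Longrightarrow> x ^ n \<in> S"
proof -
  have *: "0 \<in> S" "1 \<in> S" "\<And>x y. x \<in> S \<Longrightarrow> y \<in> S \<Longrightarrow> x + y \<in> S"
    "\<And>x y. x \<in> S \<Longrightarrow> y \<in> S \<Longrightarrow> x - y \<in> S" "\<And>x y. x \<in> S \<Longrightarrow> y \<in> S \<Longrightarrow> x * y \<in> S"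
    using assms by (auto simp: is_subfield_def)
  moreover have i: "\<And>x. x \<in> S \<Longrightarrow> inverse x \<in> S"
    using assms by (metis inverse_zero is_subfield_def)
  moreover have "\<And>x y. x \<in> S \<Longrightarrow> y \<in> S \<Longrightarrow> x / y \<in> S"
    using * i by (simp add: divide_inverse)
  moreover have "\<And>x. x \<in> S \<Longrightarrow> - x \<in> S"
    using *(1) *(4)[of 0] by simp
  moreover have "\<And>x. x \<in> S \<Longrightarrow> x ^ n \<in> S"
    by (induction n) (use * in auto)
  ultimately show "0 \<in> S" "1 \<in> S" "x \<in> S \<Longrightarrow> y \<in> S \<Longrightarrow> x + y \<in> S" "x \<in> S \<Longrightarrow> y \<in> S \<Longrightarrow> x - y \<in> S"
    "x \<in> S \<Longrightarrow> y \<in> S \<Longrightarrow> x * y \<in> S" "x \<in> S \<Longrightarrow> inverse x \<in> S"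
    "x \<in> S \<Longrightarrow> y \<in> S \<Longrightarrow> x / y \<in> S" "x \<in> S \<Longrightarrow> - x \<in> S" "x \<in> S \<Longrightarrow> x ^ n \<in> S"
    by auto
qed

lemma subfield_sum:
  assumes "is_subfield S" "\<And>i. i \<in> I \<Longrightarrow> f i \<in> S"
  shows "sum f I \<in> S"
  using assms(2)
  by (induction I rule: infinite_finite_induct) (auto simp: is_subfieldD[OF assms(1)])

lemma over_iff_coeffs: "0 \<in> S \<Longrightarrow> f \<in> over S \<longleftrightarrow> set (coeffs f) \<subseteq> S"
proof -
  assume "0 \<in> S"
  then have "f \<in> over S \<longleftrightarrow> range (coeff f) \<subseteq> S" by (auto simp: over_def)
  with \<open>0 \<in> S\<close> show ?thesis by (simp add: range_coeff)
qed

lemma over_mono: "S \<subseteq> T \<Longrightarrow> f \<in> over S \<Longrightarrow> f \<in> over T"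
  by (auto simp: over_def)

lemma over_coeff: "f \<in> over S \<Longrightarrow> coeff f n \<in> S"
  by (auto simp: over_def)

context
  fixes S :: "'a::field set"
  assumes S: "is_subfield S"
begin

lemmas S_simps = is_subfieldD[OF S]

lemma over_0: "0 \<in> over S" and over_1: "1 \<in> over S"
  by (auto simp: over_def S_simps)

lemma over_pCons: "pCons c f \<in> over S \<longleftrightarrow> c \<in> S \<and> f \<in> over S"
proof
  assume "pCons c f \<in> over S"
  then have *: "coeff (pCons c f) n \<in> S" for n by (simp add: over_def)
  show "c \<in> S \<and> f \<in> over S"
    using *[of 0] *[of "Suc n" for n] by (simp add: over_def)
next
  assume "c \<in> S \<and> f \<in> over S"
  then show "pCons c f \<in> over S" by (simp add: over_def coeff_pCons split: nat.split)
qed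

lemma over_const: "[:c:] \<in> over S \<longleftrightarrow> c \<in> S"
  by (simp add: over_pCons over_0)

lemma over_add: "f \<in> over S \<Longrightarrow> g \<in> over S \<Longrightarrow> f + g \<in> over S"
  and over_diff: "f \<in> over S \<Longrightarrow> g \<in> over S \<Longrightarrow> f - g \<in> over S"
  and over_smult: "c \<in> S \<Longrightarrow> f \<in> over S \<Longrightarrow> smult c f \<in> over S"
  by (auto simp: over_def S_simps)

lemma over_mult: "f \<in> over S \<Longrightarrow> g \<in> over S \<Longrightarrow> f * g \<in> over S"
  by (auto simp: over_def S_simps coeff_mult intro!: subfield_sum[OF S])

lemma over_power: "f \<in> over S \<Longrightarrow> f ^ n \<in> over S"
  by (induction n) (auto simp: over_1 over_mult)

lemma over_monom: "c \<in> S \<Longrightarrow> monom c n \<in> over S"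
  by (auto simp: over_def S_simps)

lemma over_sum: "(\<And>i. i \<in> I \<Longrightarrow> f i \<in> over S) \<Longrightarrow> sum f I \<in> over S"
  by (auto simp: over_def S_simps coeff_sum intro!: subfield_sum[OF S])

lemma over_pderiv: "f \<in> over S \<Longrightarrow> pderiv f \<in> over S"
proof -
  have "of_nat n \<in> S" for n by (induction n) (auto simp: S_simps)
  then show "f \<in> over S \<Longrightarrow> pderiv f \<in> over S"
    unfolding over_def coeff_pderiv mem_Collect_eq using S_simps(5) by blast
qed

lemma over_pcompose: "f \<in> over S \<Longrightarrow> g \<in> over S \<Longrightarrow> pcompose f g \<in> over S"
  by (induction f) (auto simp: over_0 pcompose_pCons over_pCons intro!: over_add over_mult)

lemma over_poly: "f \<in> over S \<Longrightarrow> x \<in> S \<Longrightarrow> poly f x \<in> S"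
  by (induction f) (auto simp: over_pCons S_simps)

section \<open>Euclidean division, gcds and minimal polynomials over a subfield\<close>

lemma over_division:
  assumes "f \<in> over S" "g \<in> over S" "g \<noteq> 0"
  shows "\<exists>u\<in>over S. \<exists>v\<in>over S. f = u * g + v \<and> (v = 0 \<or> degree v < degree g)"
  using assms(1)
proof (induction "degree f" arbitrary: f rule: less_induct)
  case less
  show ?case
  proof (cases "f = 0 \<or> degree f < degree g")
    case True
    then show ?thesis using less.prems over_0 by (intro bexI[of _ 0] bexI[of _ f]) auto
  next
    case False
    then have f: "f \<noteq> 0" "degree g \<le> degree f" by auto
    define m where "m = monom (lead_coeff f / lead_coeff g) (degree f - degree g)"
    define f' where "f' = f - m * g"
    have m: "m \<in> over S"
      unfolding m_def using less.prems assms by (intro over_monom S_simps(7)) (auto simp: over_coeff)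
    have f': "f' \<in> over S" unfolding f'_def using m less.prems assms over_diff over_mult by blast
    have lc: "lead_coeff f / lead_coeff g \<noteq> 0" using f assms(3) by simp
    have dm: "degree (m * g) = degree f"
      using lc f assms(3) by (simp add: m_def degree_mult_eq degree_monom_eq)
    have "coeff (m * g) (degree f) = lead_coeff f"
      using dm lead_coeff_mult[of m g] lc f assms(3)
      by (simp add: m_def degree_monom_eq)
    then have "coeff f' (degree f) = 0" by (simp add: f'_def)
    moreover have "degree f' \<le> degree f"
      unfolding f'_def by (rule degree_diff_le) (use dm in auto)
    ultimately have *: "f' = 0 \<or> degree f' < degree f"
      by (metis eq_zero_or_degree_less)
    show ?thesis
    proof (cases "f' = 0")
      case True
      then have "f = m * g + 0" by (simp add: f'_def)
      then show ?thesis using m over_0 by blast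
    next
      case False
      with * less.hyps f' obtain u v where uv: "u \<in> over S" "v \<in> over S" "f' = u * g + v"
        "v = 0 \<or> degree v < degree g" by blast
      then have "f = (m + u) * g + v" by (simp add: f'_def algebra_simps)
      then show ?thesis using uv over_add[OF m uv(1)] by blast
    qed
  qed
qed

text \<open>An element of least degree in the ideal (f, g) of S[X] divides both generators. All
  cofactors are returned explicitly, because divisibility in the ambient polynomial ring would not
  record that they lie over \<open>S\<close>.\<close>

lemma over_bezout:
  assumes "f \<in> over S" "g \<in> over S" "f \<noteq> 0"
  obtains u v d h k where "u \<in> over S" "v \<in> over S" "d \<in> over S" "h \<in> over S" "k \<in> over S"
    "d = u * f + v * g" "d \<noteq> 0" "f = h * d" "g = k * d"
proof -
  define I where "I = {u * f + v * g | u v. u \<in> over S \<and> v \<in> over S}"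
  have fI: "f \<in> I" and gI: "g \<in> I"
    unfolding I_def using over_0 over_1 by force+
  define d where "d = arg_min degree (\<lambda>d. d \<in> I \<and> d \<noteq> 0)"
  have d: "d \<in> I \<and> d \<noteq> 0"
    unfolding d_def by (rule arg_min_natI[of _ f]) (use fI assms in auto)
  have min: "degree d \<le> degree e" if "e \<in> I" "e \<noteq> 0" for e
    unfolding d_def by (rule arg_min_nat_le) (use that in auto)
  have dvd: "\<exists>h\<in>over S. e = h * d" if e: "e \<in> I" for e
  proof -
    have eS: "e \<in> over S" and dS: "d \<in> over S"
      using e d assms unfolding I_def by (auto intro!: over_add over_mult)
    obtain u v where uv: "u \<in> over S" "v \<in> over S" "e = u * d + v" "v = 0 \<or> degree v < degree d"
      using over_division[OF eS dS] d by blast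
    obtain a b where ab: "a \<in> over S" "b \<in> over S" "e = a * f + b * g" using e by (auto simp: I_def)
    obtain a' b' where ab': "a' \<in> over S" "b' \<in> over S" "d = a' * f + b' * g"
      using d by (auto simp: I_def)
    have "v = (a - u * a') * f + (b - u * b') * g"
      using uv(3) ab(3) ab'(3) by (simp add: algebra_simps)
    then have "v \<in> I"
      unfolding I_def using ab ab' uv by (blast intro: over_diff over_mult)
    with min[of v] uv(4) have "v = 0" by force
    with uv show ?thesis by auto
  qed
  obtain u v where "u \<in> over S" "v \<in> over S" "d = u * f + v * g" using d by (auto simp: I_def)
  moreover from this have "d \<in> over S" using assms by (simp add: over_add over_mult)
  moreover obtain h k where "h \<in> over S" "f = h * d" "k \<in> over S" "g = k * d"
    using dvd[OF fI] dvd[OF gI] by blast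
  ultimately show ?thesis using that d by metis
qed

text \<open>Division with remainder turns minimal degree into divisibility, as the remainder
  vanishes at \<open>x\<close> and is too short. The two forms of minimality stand in for
  irreducibility.\<close>

lemma over_minpoly:
  assumes "f \<in> over S" "f \<noteq> 0" "poly f x = 0"
  obtains g where "g \<in> over S" "g \<noteq> 0" "poly g x = 0"
    "\<And>h. h \<in> over S \<Longrightarrow> h \<noteq> 0 \<Longrightarrow> poly h x = 0 \<Longrightarrow> degree g \<le> degree h"
    "\<And>h. h \<in> over S \<Longrightarrow> poly h x = 0 \<Longrightarrow> \<exists>k\<in>over S. h = k * g"
proof -
  define g where "g = arg_min degree (\<lambda>g. g \<in> over S \<and> g \<noteq> 0 \<and> poly g x = 0)"
  have g: "g \<in> over S \<and> g \<noteq> 0 \<and> poly g x = 0"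
    unfolding g_def by (rule arg_min_natI[of _ f]) (use assms in auto)
  have min: "degree g \<le> degree h" if "h \<in> over S" "h \<noteq> 0" "poly h x = 0" for h
    unfolding g_def by (rule arg_min_nat_le) (use that in auto)
  have "\<exists>k\<in>over S. h = k * g" if h: "h \<in> over S" "poly h x = 0" for h
  proof -
    obtain u v where uv: "u \<in> over S" "v \<in> over S" "h = u * g + v" "v = 0 \<or> degree v < degree g"
      using over_division[OF h(1)] g by blast
    then have "poly v x = 0" using h g by simp
    with min[of v] uv have "v = 0" by force
    with uv show ?thesis by auto
  qed
  with g min show ?thesis using that by blast
qed

text \<open>Gaussian elimination only uses field operations on the coefficients, so a nontrivial solution
  in the big field descends to the coefficient field.\<close>
lemma linear_system_descent:
  fixes a :: "'i \<Rightarrow> nat \<Rightarrow> 'a"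
  assumes "finite I" "\<And>i j. i \<in> I \<Longrightarrow> j < n \<Longrightarrow> a i j \<in> S"
    and "n < card I \<or> (\<exists>c. (\<exists>i\<in>I. c i \<noteq> 0) \<and> (\<forall>j<n. (\<Sum>i\<in>I. c i * a i j) = 0))"
  shows "\<exists>c. (\<forall>i\<in>I. c i \<in> S) \<and> (\<exists>i\<in>I. c i \<noteq> 0) \<and> (\<forall>j<n. (\<Sum>i\<in>I. c i * a i j) = 0)"
  using assms
proof (induction n arbitrary: I a)
  case 0
  then have "I \<noteq> {}" by auto
  then show ?case by (intro exI[of _ "\<lambda>_. 1"]) (use S_simps(2) in auto)
next
  case (Suc n)
  show ?case
  proof (cases "\<forall>i\<in>I. a i n = 0")
    case True
    have "n < card I \<or> (\<exists>c. (\<exists>i\<in>I. c i \<noteq> 0) \<and> (\<forall>j<n. (\<Sum>i\<in>I. c i * a i j) = 0))"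
      using Suc.prems(3) by auto
    then obtain c where "\<forall>i\<in>I. c i \<in> S" "\<exists>i\<in>I. c i \<noteq> 0" "\<forall>j<n. (\<Sum>i\<in>I. c i * a i j) = 0"
      using Suc.IH[of I a] Suc.prems(1,2) by auto
    then show ?thesis using True by (intro exI[of _ c]) (auto simp: less_Suc_eq)
  next
    case False
    then obtain l where l: "l \<in> I" "a l n \<noteq> 0" by blast
    define I' where "I' = I - {l}"
    have I': "finite I'" "l \<notin> I'" "I = insert l I'" "card I = Suc (card I')"
      using l Suc.prems(1) card.remove[OF Suc.prems(1) l(1)] by (auto simp: I'_def)
    \<comment> \<open>Equation \<open>n\<close> is solved for the pivot unknown \<open>c l\<close>;
      \<open>b\<close> holds the coefficients of the other equations after substitution.\<close>
    define b where "b i j = a i j - a i n / a l n * a l j" for i j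
    have elim: "(\<Sum>i\<in>I'. c i * b i j) =
        (\<Sum>i\<in>I. c i * a i j) - (\<Sum>i\<in>I. c i * a i n) / a l n * a l j" for c j
    proof -
      have "(\<Sum>i\<in>I'. c i * b i j) = (\<Sum>i\<in>I. c i * b i j)"
        using I' l by (simp add: b_def)
      also have "\<dots> = (\<Sum>i\<in>I. c i * a i j) - (\<Sum>i\<in>I. c i * a i n * (a l j / a l n))"
        by (simp add: b_def algebra_simps sum_subtractf)
      finally show ?thesis by (simp add: sum_distrib_right sum_divide_distrib)
    qed
    have bS: "b i j \<in> S" if "i \<in> I'" "j < n" for i j
      unfolding b_def using that I' Suc.prems(2) by (intro S_simps) auto
    have "n < card I' \<or> (\<exists>c. (\<exists>i\<in>I'. c i \<noteq> 0) \<and> (\<forall>j<n. (\<Sum>i\<in>I'. c i * b i j) = 0))"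
      using Suc.prems(3)
    proof
      assume "\<exists>c. (\<exists>i\<in>I. c i \<noteq> 0) \<and> (\<forall>j<Suc n. (\<Sum>i\<in>I. c i * a i j) = 0)"
      then obtain c where c: "\<exists>i\<in>I. c i \<noteq> 0" "\<And>j. j < Suc n \<Longrightarrow> (\<Sum>i\<in>I. c i * a i j) = 0" by blast
      \<comment> \<open>A solution supported at \<open>l\<close> alone would violate equation
        \<open>n\<close>, so nontriviality survives the elimination.\<close>
      have "\<exists>i\<in>I'. c i \<noteq> 0"
      proof (rule ccontr)
        assume *: "\<not> ?thesis"
        with c I' have "c l \<noteq> 0" by auto
        moreover have "(\<Sum>i\<in>I. c i * a i n) = c l * a l n" using I' * by simp
        ultimately show False using c(2)[of n] l by simp
      qed
      then show ?thesis using c(2) elim by auto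
    qed (use I' in auto)
    from Suc.IH[OF I'(1) bS this] obtain c where
      c: "\<forall>i\<in>I'. c i \<in> S" "\<exists>i\<in>I'. c i \<noteq> 0" "\<And>j. j < n \<Longrightarrow> (\<Sum>i\<in>I'. c i * b i j) = 0" by blast
    define c' where "c' = c(l := - (\<Sum>i\<in>I'. c i * a i n) / a l n)"
    have "(\<Sum>i\<in>I'. c' i * x i) = (\<Sum>i\<in>I'. c i * x i)" for x
      by (rule sum.cong) (use I' in \<open>auto simp: c'_def\<close>)
    note c'sum = this
    have z: "(\<Sum>i\<in>I. c' i * a i n) = 0"
      using I' l c'sum by (simp add: c'_def)
    have "(\<Sum>i\<in>I. c' i * a i j) = 0" if "j < Suc n" for j
    proof (cases "j = n")
      case False
      with that have "(\<Sum>i\<in>I'. c' i * b i j) = 0" using c'sum c(3) by simp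
      then show ?thesis using elim z by simp
    qed (use z in simp)
    moreover have "\<forall>i\<in>I. c' i \<in> S"
      unfolding c'_def using c(1) I' l Suc.prems(2)
      by (auto intro!: S_simps(7) S_simps(8) S_simps(5) subfield_sum[OF S])
    moreover have "\<exists>i\<in>I. c' i \<noteq> 0" using c(2) I' by (auto simp: c'_def)
    ultimately show ?thesis by blast
  qed
qed

text \<open>Writing n + 1 powers of \<open>x\<close> in terms of n elements leaves n equations in n
  + 1 unknowns. The degree bound later limits the roots of t in K and bounds the inseparable degree
  from below.\<close>

lemma annihilator_of_span:
  assumes "\<And>i. i \<le> length xs \<Longrightarrow> x ^ i \<in> span_over S xs"
  shows "\<exists>f\<in>over S. f \<noteq> 0 \<and> degree f \<le> length xs \<and> poly f x = 0"
proof -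
  define n where "n = length xs"
  have "\<forall>i\<le>n. \<exists>c. x ^ i = (\<Sum>j<n. c j * xs ! j) \<and> (\<forall>j<n. c j \<in> S)"
    using assms unfolding span_over_def n_def by blast
  then obtain a where a: "\<And>i. i \<le> n \<Longrightarrow> x ^ i = (\<Sum>j<n. a i j * xs ! j)"
    "\<And>i j. i \<le> n \<Longrightarrow> j < n \<Longrightarrow> a i j \<in> S" by metis
  have "\<exists>c. (\<forall>i\<in>{..n}. c i \<in> S) \<and> (\<exists>i\<in>{..n}. c i \<noteq> 0) \<and> (\<forall>j<n. (\<Sum>i\<in>{..n}. c i * a i j) = 0)"
    by (rule linear_system_descent) (use a in auto)
  then obtain c where c: "\<And>i. i \<le> n \<Longrightarrow> c i \<in> S" "\<exists>i\<le>n. c i \<noteq> 0"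
    "\<And>j. j < n \<Longrightarrow> (\<Sum>i\<le>n. c i * a i j) = 0" by auto
  define f where "f = (\<Sum>i\<le>n. monom (c i) i)"
  have cf: "coeff f i = (if i \<le> n then c i else 0)" for i
    by (simp add: f_def coeff_sum)
  have "poly f x = (\<Sum>i\<le>n. c i * x ^ i)" by (simp add: f_def poly_sum poly_monom)
  also have "\<dots> = (\<Sum>i\<le>n. \<Sum>j<n. c i * a i j * xs ! j)"
    by (rule sum.cong) (simp_all add: a(1) sum_distrib_left mult.assoc)
  also have "\<dots> = (\<Sum>j<n. (\<Sum>i\<le>n. c i * a i j) * xs ! j)"
    by (subst sum.swap) (simp add: sum_distrib_right)
  also have "\<dots> = 0" using c(3) by simp
  finally have "poly f x = 0" .
  moreover have "f \<noteq> 0" using c(2) cf by (metis coeff_0)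
  moreover have "f \<in> over S" using c(1) S_simps by (auto simp: over_def cf)
  moreover have "degree f \<le> n" by (rule degree_le) (simp add: cf)
  ultimately show ?thesis by (auto simp: n_def)
qed

end

section \<open>Purely inseparable and separable elements\<close>

locale closed_char_p =
  fixes p :: nat and ambient :: "'a::field itself"
  assumes prime_p: "prime p" and CHAR_p: "CHAR('a) = p" and closed: "alg_closed TYPE('a)"
begin

section \<open>Frobenius on an algebraically closed field of characteristic p\<close>

lemma p_pos: "0 < p" and p_gt_1: "1 < p"
  using prime_p prime_gt_0_nat prime_gt_1_nat by auto

lemma frob_add: "(x + y :: 'a) ^ (p ^ n) = x ^ (p ^ n) + y ^ (p ^ n)"
  using freshmans_dream'[of "p ^ n" n x y] prime_p CHAR_p by simp

lemma frob_add_poly: "(f + g :: 'a poly) ^ (p ^ n) = f ^ (p ^ n) + g ^ (p ^ n)"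
  using freshmans_dream'[where 'a = "'a poly", of "p ^ n" n f g] prime_p CHAR_p by simp

lemma frob_sum: "(sum f I :: 'a) ^ (p ^ n) = (\<Sum>i\<in>I. f i ^ (p ^ n))"
  using freshmans_dream_sum'[of "p ^ n" n f I] prime_p CHAR_p by simp

lemma frob_diff: "(x - y :: 'a) ^ (p ^ n) = x ^ (p ^ n) - y ^ (p ^ n)"
  using frob_add[of "x - y" y n] by (simp add: algebra_simps)

lemma frob_eq_iff: "(x :: 'a) ^ (p ^ n) = y ^ (p ^ n) \<longleftrightarrow> x = y"
proof
  assume "x ^ (p ^ n) = y ^ (p ^ n)"
  then have "(x - y) ^ (p ^ n) = 0" by (simp add: frob_diff)
  then show "x = y" by simp
qed simp

lemma frob_0: "(0 :: 'a) ^ (p ^ n) = 0"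
  using p_pos by (simp add: power_0_left)

lemma degree_monom_diff_const:
  assumes "0 < n"
  shows "degree (monom 1 n - [:c :: 'a:]) = n"
proof -
  have "degree (monom 1 n + [:-c:]) = degree (monom (1 :: 'a) n)"
    by (rule degree_add_eq_left) (use assms in \<open>simp add: degree_monom_eq\<close>)
  moreover have "monom 1 n + [:-c:] = monom 1 n - [:c:]" by simp
  ultimately show ?thesis by (simp add: degree_monom_eq)
qed

lemma root_exists:
  assumes "0 < n"
  shows "\<exists>y :: 'a. y ^ n = x"
proof -
  have "0 < degree (monom 1 n - [:x:])"
    using assms by (simp add: degree_monom_diff_const)
  then obtain y where "poly (monom 1 n - [:x:]) y = 0"
    using closed unfolding alg_closed_def by blast
  then show ?thesis by (auto simp: poly_monom)
qed

lemma frob_root_exists: "\<exists>y :: 'a. y ^ (p ^ n) = x"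
  by (rule root_exists) (simp add: p_pos)

text \<open>Linear factors are split off one at a time: a simple root of \<open>f\<close> is not a
  root of the cofactor, so each factor contributes a new root.\<close>

lemma card_roots_simple:
  fixes f :: "'a poly"
  assumes "f \<noteq> 0" "\<And>z. poly f z = 0 \<Longrightarrow> poly (pderiv f) z \<noteq> 0"
  shows "card {z. poly f z = 0} = degree f"
  using assms
proof (induction "degree f" arbitrary: f rule: less_induct)
  case less
  show ?case
  proof (cases "degree f = 0")
    case True
    then obtain c where "f = [:c:]" by (rule degree_eq_zeroE)
    with less.prems show ?thesis by simp
  next
    case False
    then obtain z where z: "poly f z = 0" using closed unfolding alg_closed_def by blast
    then obtain h where h: "f = [:-z, 1:] * h" by (auto simp: poly_eq_0_iff_dvd elim: dvdE)
    have h0: "h \<noteq> 0" using h less.prems(1) by auto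
    have deg: "degree f = Suc (degree h)"
      unfolding h using h0 by (subst degree_mult_eq) auto
    have pd: "pderiv f = h + [:-z, 1:] * pderiv h"
      unfolding h by (simp only: pderiv_mult) (simp add: pderiv_pCons)
    have hz: "poly h z \<noteq> 0" using less.prems(2)[OF z] by (simp add: pd)
    have "poly (pderiv h) w \<noteq> 0" if "poly h w = 0" for w
    proof -
      have "poly f w = 0" using that by (simp add: h)
      from less.prems(2)[OF this] show ?thesis using that by (auto simp: pd)
    qed
    with less.hyps[of h] deg h0 have "card {w. poly h w = 0} = degree h" by simp
    moreover have "{w. poly f w = 0} = insert z {w. poly h w = 0}"
      by (auto simp: h)
    moreover have "finite {w. poly h w = 0}" using h0 by (rule poly_roots_finite)
    ultimately show ?thesis using hz deg by simp
  qed
qed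

lemma subfield_frob_image:
  assumes "is_subfield (M :: 'a set)"
  shows "is_subfield ((\<lambda>x. x ^ (p ^ n)) ` M)"
  unfolding is_subfield_def
proof (intro conjI ballI impI)
  note M = is_subfieldD[OF assms]
  show "0 \<in> (\<lambda>x. x ^ (p ^ n)) ` M" using frob_0 M(1) by (metis imageI)
  show "1 \<in> (\<lambda>x. x ^ (p ^ n)) ` M" using M(2) by force
  fix x y assume "x \<in> (\<lambda>x. x ^ (p ^ n)) ` M" "y \<in> (\<lambda>x. x ^ (p ^ n)) ` M"
  then obtain a b where ab: "a \<in> M" "b \<in> M" "x = a ^ (p ^ n)" "y = b ^ (p ^ n)" by blast
  show "x + y \<in> (\<lambda>x. x ^ (p ^ n)) ` M"
    using ab M(3)[of a b] by (auto simp: frob_add[symmetric])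
  show "x - y \<in> (\<lambda>x. x ^ (p ^ n)) ` M"
    using ab M(4)[of a b] by (auto simp: frob_diff[symmetric])
  show "x * y \<in> (\<lambda>x. x ^ (p ^ n)) ` M"
    using ab M(5)[of a b] by (auto simp: power_mult_distrib[symmetric])
next
  note M = is_subfieldD[OF assms]
  fix x assume "x \<in> (\<lambda>x. x ^ (p ^ n)) ` M"
  then obtain a where ab: "a \<in> M" "x = a ^ (p ^ n)" by blast
  then show "inverse x \<in> (\<lambda>x. x ^ (p ^ n)) ` M"
    using M(6)[of a] by (auto simp: power_inverse[symmetric])
qed

text \<open>This is the field M^(1/p) inside the ambient field; the coefficients in Mac Lane's
  criterion range over it.\<close>

lemma subfield_frob_preimage:
  assumes "is_subfield (M :: 'a set)"
  shows "is_subfield {x. x ^ p \<in> M}"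
  unfolding is_subfield_def
  using is_subfieldD[OF assms] frob_add[where n = 1] frob_diff[where n = 1] p_pos
  by (auto simp: power_mult_distrib power_inverse power_0_left)

section \<open>Simple purely inseparable extensions\<close>

definition adj :: "'a set \<Rightarrow> 'a \<Rightarrow> 'a set" where
  "adj M x = {poly f x | f. f \<in> over M}"

lemma adj_base: "is_subfield M \<Longrightarrow> c \<in> M \<Longrightarrow> c \<in> adj M x"
  unfolding adj_def by (auto intro!: exI[of _ "[:c:]"] simp: over_const)

lemma adj_gen: "is_subfield M \<Longrightarrow> x \<in> adj M x"
  unfolding adj_def by (auto intro!: exI[of _ "[:0, 1:]"] simp: over_pCons over_0 is_subfieldD)

lemma frob_poly_in_base:
  assumes M: "is_subfield (M :: 'a set)" and x: "x ^ (p ^ k) \<in> M" and y: "y \<in> adj M x"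
  shows "y ^ (p ^ k) \<in> M"
proof -
  have "poly f x ^ (p ^ k) \<in> M" if "f \<in> over M" for f
    using that
    by (induction f)
      (auto simp: over_pCons[OF M] frob_0 frob_add power_mult_distrib is_subfieldD(1)[OF M]
        intro!: is_subfieldD(3,5,9)[OF M] x)
  with y show ?thesis by (auto simp: adj_def)
qed

text \<open>\<open>adj M x\<close> is only the ring M[x]. It is a field here because a^(p^k) lies in
  \<open>M\<close>, so a^(p^k - 1) divided by that element inverts a.\<close>

lemma subfield_adj:
  assumes M: "is_subfield (M :: 'a set)" and x: "x ^ (p ^ k) \<in> M"
  shows "is_subfield (adj M x)"
proof -
  have ring: "a + b \<in> adj M x" "a - b \<in> adj M x" "a * b \<in> adj M x"
    if ab: "a \<in> adj M x" "b \<in> adj M x" for a b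
  proof -
    obtain f g where fg: "f \<in> over M" "g \<in> over M" "a = poly f x" "b = poly g x"
      using ab by (auto simp: adj_def)
    show "a + b \<in> adj M x"
      unfolding adj_def using fg over_add[OF M, of f g] by (auto intro!: exI[of _ "f + g"])
    show "a - b \<in> adj M x"
      unfolding adj_def using fg over_diff[OF M, of f g] by (auto intro!: exI[of _ "f - g"])
    show "a * b \<in> adj M x"
      unfolding adj_def using fg over_mult[OF M, of f g] by (auto intro!: exI[of _ "f * g"])
  qed
  have one: "1 \<in> adj M x" and zero: "0 \<in> adj M x"
    by (auto intro!: adj_base[OF M] is_subfieldD[OF M])
  have pow: "a ^ n \<in> adj M x" if "a \<in> adj M x" for a n
    by (induction n) (use that one ring in auto)
  have "inverse a \<in> adj M x" if a: "a \<in> adj M x" "a \<noteq> 0" for a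
  proof -
    have "a ^ (p ^ k - 1) * a = a ^ (p ^ k)"
      using p_pos by (metis mult.commute power_minus_mult zero_less_power)
    then have "inverse a = a ^ (p ^ k - 1) * inverse (a ^ (p ^ k))"
      using a(2) by (simp add: field_simps)
    moreover have "inverse (a ^ (p ^ k)) \<in> adj M x"
      by (intro adj_base[OF M] is_subfieldD[OF M] frob_poly_in_base[OF M x a(1)])
    ultimately show ?thesis using ring pow a by metis
  qed
  with ring one zero show ?thesis by (auto simp: is_subfield_def)
qed

text \<open>Take the remainder modulo X^N - x^N, which lies over \<open>M\<close> and vanishes at
  \<open>x\<close>.\<close>

lemma adj_reduce:
  assumes M: "is_subfield (M :: 'a set)" and x: "x ^ N \<in> M" "0 < N" and y: "y \<in> adj M x"
  obtains v where "v \<in> over M" "degree v < N" "y = poly v x"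
proof -
  obtain f where f: "f \<in> over M" "y = poly f x" using y by (auto simp: adj_def)
  define g where "g = monom 1 N - [:x ^ N:]"
  have g: "g \<in> over M"
    unfolding g_def using x by (intro over_diff[OF M] over_monom[OF M]) (auto simp: over_const M is_subfieldD)
  have dg: "degree g = N"
    unfolding g_def using x(2) by (rule degree_monom_diff_const)
  then have "g \<noteq> 0" using x by auto
  from over_division[OF M f(1) g this] obtain u v where
    uv: "u \<in> over M" "v \<in> over M" "f = u * g + v" "v = 0 \<or> degree v < N" by (auto simp: dg)
  have "poly g x = 0" by (simp add: g_def poly_monom)
  then have "y = poly v x" using f uv by simp
  moreover have "degree v < N" using uv(4) x by auto
  ultimately show ?thesis using uv that by blast
qed

text \<open>Since (X - x)^(p^k) = X^(p^k) - x^(p^k) lies over \<open>M\<close>, the minimal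
  polynomial of \<open>x\<close> divides it and has \<open>x\<close> as its only root. Made monic,
  it is a power of X - x.\<close>

lemma purely_insep_minpoly:
  assumes M: "is_subfield (M :: 'a set)" and x: "x ^ (p ^ k) \<in> M"
  obtains d where "0 < d" "[:-x, 1:] ^ d \<in> over M"
    "\<And>f. f \<in> over M \<Longrightarrow> poly f x = 0 \<Longrightarrow> [:-x, 1:] ^ d dvd f"
proof -
  define P where "P = [:-x, 1:] ^ (p ^ k)"
  have "[:-x, 1:] = monom 1 1 + [:-x:]" by (simp add: monom_Suc)
  then have "P = monom 1 1 ^ (p ^ k) + [:-x:] ^ (p ^ k)"
    unfolding P_def by (simp only: frob_add_poly)
  then have "P = monom 1 (p ^ k) + [:(-x) ^ (p ^ k):]"
    by (simp only: monom_power poly_const_pow power_one mult_1_left)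
  moreover have "(-x) ^ (p ^ k) \<in> M"
    using is_subfieldD(8)[OF M x] frob_diff[of 0 x k] by (simp add: frob_0)
  ultimately have P: "P \<in> over M"
    by (auto intro!: over_add[OF M] over_monom[OF M] simp: over_const M is_subfieldD)
  have "P \<noteq> 0" by (simp add: P_def)
  moreover have "poly P x = 0" using p_pos by (simp add: P_def power_0_left)
  note P0 = calculation this
  obtain g where g: "g \<in> over M" "g \<noteq> 0" "poly g x = 0"
    "\<And>h. h \<in> over M \<Longrightarrow> poly h x = 0 \<Longrightarrow> \<exists>k\<in>over M. h = k * g"
    by (rule over_minpoly[OF M P P0], rule that) blast+
  define d where "d = order x g"
  obtain h where h: "g = [:-x, 1:] ^ d * h" "\<not> [:-x, 1:] dvd h"
    using order_decomp[OF g(2), of x] by (auto simp: d_def)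
  \<comment> \<open>A root of the cofactor \<open>h\<close> would be a root of \<open>P\<close>,
    hence \<open>x\<close> itself, although \<open>d\<close> is already the full multiplicity of
    \<open>x\<close>.\<close>
  have "degree h = 0"
  proof (rule ccontr)
    assume "degree h \<noteq> 0"
    then obtain z where z: "poly h z = 0" using closed unfolding alg_closed_def by blast
    obtain e where "P = e * g" using g(4)[OF P \<open>poly P x = 0\<close>] by blast
    then have "poly P z = 0" using z h by simp
    then have "z = x" by (simp add: P_def)
    with z h(2) show False by (simp add: poly_eq_0_iff_dvd)
  qed
  then obtain c where c: "h = [:c:]" by (rule degree_eq_zeroE)
  have gc: "g = smult c ([:-x, 1:] ^ d)" using h c by simp
  then have c0: "c \<noteq> 0" using g by auto
  have "lead_coeff g = c" by (simp add: gc lead_coeff_power)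
  then have "c \<in> M" using g(1) over_coeff by metis
  have "[:-x, 1:] ^ d = smult (inverse c) g" using gc c0 by simp
  then have dM: "[:-x, 1:] ^ d \<in> over M"
    using \<open>c \<in> M\<close> g(1) over_smult[OF M] is_subfieldD(6)[OF M] by metis
  have "0 < d" using g(2,3) by (simp add: d_def order_root)
  moreover have "[:-x, 1:] ^ d dvd f" if f: "f \<in> over M" "poly f x = 0" for f
  proof -
    obtain e where "f = e * g" using g(4)[OF f] by blast
    then show ?thesis by (simp add: h)
  qed
  ultimately show ?thesis using that dM by blast
qed

text \<open>The minimal polynomial (X - x)^d of \<open>x\<close> over \<open>M\<close> divides a
  polynomial without multiple roots, so d = 1 and its constant coefficient -x lies in
  \<open>M\<close>.\<close>

lemma separable_purely_insep_mem:
  assumes M: "is_subfield (M :: 'a set)" and F: "F \<subseteq> M" "0 \<in> F" and sep: "separable_over F x" and x: "x ^ (p ^ k) \<in> M"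
  shows "x \<in> M"
proof -
  obtain f where f: "f \<noteq> 0" "set (coeffs f) \<subseteq> F" "poly f x = 0" "coprime f (pderiv f)"
    using sep by (auto simp: separable_over_def)
  have "f \<in> over M" using f(2) F over_iff_coeffs[of F f] over_mono by blast
  obtain d where d: "0 < d" "[:-x, 1:] ^ d \<in> over M"
    "\<And>f. f \<in> over M \<Longrightarrow> poly f x = 0 \<Longrightarrow> [:-x, 1:] ^ d dvd f"
    using that by (rule purely_insep_minpoly[OF M x])
  have "d = 1"
  proof (rule ccontr)
    assume "d \<noteq> 1"
    then have "[:-x, 1:] ^ 2 dvd [:-x, 1:] ^ d" using d(1) by (intro le_imp_power_dvd) auto
    then have "[:-x, 1:] ^ 2 dvd f" using d(3) f(3) \<open>f \<in> over M\<close> dvd_trans by blast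
    then obtain h where "f = [:-x, 1:] ^ 2 * h" ..
    then have fh: "f = [:-x, 1:] * ([:-x, 1:] * h)" by (simp only: power2_eq_square mult.assoc)
    have "pderiv f = [:-x, 1:] * pderiv ([:-x, 1:] * h) + ([:-x, 1:] * h) * pderiv [:-x, 1:]"
      unfolding fh by (rule pderiv_mult)
    also have "[:-x, 1:] dvd \<dots>"
      by (intro dvd_add dvd_triv_left dvd_mult2)
    finally have "[:-x, 1:] dvd f" "[:-x, 1:] dvd pderiv f" by (simp_all only: fh dvd_triv_left)
    then have "is_unit [:-x, 1:]" using f(4) not_coprimeI by blast
    then show False by (simp add: is_unit_iff_degree)
  qed
  then have "coeff [:-x, 1:] 0 \<in> M" using d(2) over_coeff by (metis power_one_right)
  then show ?thesis using is_subfieldD(8)[OF M, of "-x"] by simp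
qed

text \<open>The powers 1, x, ..., x^(p^m - 1) are independent over \<open>M\<close>. Otherwise some
  (X - x)^d with 0 < d < p^m lies over \<open>M\<close>, and its constant coefficient puts x^d into
  \<open>M\<close>. With x^(p^m) this puts x^(p^j) into \<open>M\<close>, where p^j = gcd(d, p^m)
  and j < m.\<close>

lemma purely_insep_independent:
  assumes M: "is_subfield (M :: 'a set)" and x: "x ^ (p ^ m) \<in> M" and notin: "\<And>j. j < m \<Longrightarrow> x ^ (p ^ j) \<notin> M"
    and f: "f \<in> over M" "poly f x = 0" "degree f < p ^ m"
  shows "f = 0"
proof (rule ccontr)
  assume "f \<noteq> 0"
  obtain d where d: "0 < d" "[:-x, 1:] ^ d \<in> over M" "[:-x, 1:] ^ d dvd f"
    by (rule purely_insep_minpoly[OF M x], rule that) (use f in blast)+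
  have "d \<le> degree f"
    using dvd_imp_degree_le[OF d(3) \<open>f \<noteq> 0\<close>] by (simp add: degree_power_eq)
  then have dm: "d < p ^ m" using f by simp
  then have "0 < m" using d(1) by (cases m) auto
  then have x0: "x \<noteq> 0" using notin[of 0] is_subfieldD(1)[OF M] by auto
  have "coeff ([:-x, 1:] ^ d) 0 = (-x) ^ d" by (simp add: poly_0_coeff_0[symmetric])
  then have "(-x) ^ d \<in> M" using d(2) over_coeff by metis
  then have xd: "x ^ d \<in> M" using is_subfieldD(8)[OF M, of "(-x) ^ d"]
    by (cases "even d") auto
  have "gcd d (p ^ m) dvd p ^ m" by simp
  then obtain j where j: "j \<le> m" "gcd d (p ^ m) = p ^ j"
    using divides_primepow_nat[OF prime_p] by blast
  have "p ^ j \<le> d" using j d(1) by (metis dvd_imp_le gcd_dvd1)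
  then have "j < m" using dm j(1) by (metis le_neq_implies_less not_le)
  obtain u v where "d * u = p ^ m * v + p ^ j"
    using bezout_nat[of d "p ^ m"] d(1) j by auto
  then have "(x ^ d) ^ u = (x ^ (p ^ m)) ^ v * x ^ (p ^ j)"
    by (metis power_add power_mult)
  then have "x ^ (p ^ j) = (x ^ d) ^ u / (x ^ (p ^ m)) ^ v" using x0 by simp
  then have "x ^ (p ^ j) \<in> M" using xd x is_subfieldD(7,9)[OF M] by simp
  with notin \<open>j < m\<close> show False by blast
qed

text \<open>Mac Lane's criterion: an inseparable minimal polynomial is a polynomial in X^p, hence the p-th
  power of a polynomial over the p-th roots of elements of K, which is a shorter dependence.\<close>
lemma separable_MacLane:
  assumes K: "is_subfield (K :: 'a set)" and alg: "f0 \<in> over K" "f0 \<noteq> 0" "poly f0 z = 0"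
    and desc: "\<And>f. f \<in> over {c. c ^ p \<in> K} \<Longrightarrow> f \<noteq> 0 \<Longrightarrow> poly f z = 0 \<Longrightarrow>
      \<exists>g\<in>over K. g \<noteq> 0 \<and> degree g \<le> degree f \<and> poly g z = 0"
  shows "separable_over K z"
proof -
  obtain g where g: "g \<in> over K" "g \<noteq> 0" "poly g z = 0"
    and min: "\<And>h. h \<in> over K \<Longrightarrow> h \<noteq> 0 \<Longrightarrow> poly h z = 0 \<Longrightarrow> degree g \<le> degree h"
    by (rule over_minpoly[OF K alg], rule that) blast+
  define n where "n = degree g"
  have n: "0 < n"
  proof (rule ccontr)
    assume "\<not> ?thesis"
    then obtain c where "g = [:c:]" by (auto simp: n_def elim: degree_eq_zeroE)
    with g show False by simp
  qed
  have pg: "pderiv g \<noteq> 0"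
  proof
    assume pg: "pderiv g = 0"
    have cz: "coeff g i = 0" if "\<not> p dvd i" for i
    proof -
      have "i \<noteq> 0" using that by (intro notI) simp
      then obtain i' where i': "i = Suc i'" by (cases i) auto
      have "of_nat i * coeff g i = 0" using coeff_pderiv[of g i'] pg i' by simp
      moreover have "(of_nat i :: 'a) \<noteq> 0" using that CHAR_p by (simp add: of_nat_eq_0_iff_char_dvd)
      ultimately show ?thesis by simp
    qed
    \<comment> \<open>The aim is \<open>f\<close> with f^p = g: \<open>g\<close> has coefficients
      only at multiples of \<open>p\<close>, and \<open>f\<close> collects their p-th roots.\<close>
    obtain s where s: "\<And>c :: 'a. s c ^ p = c"
      using frob_root_exists[of 1] by (metis power_one_right)
    define c where "c i = s (coeff g (p * i))" for i
    define f where "f = (\<Sum>i\<le>n div p. monom (c i) i)"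
    have cf: "coeff f i = (if i \<le> n div p then c i else 0)" for i
      by (simp add: f_def coeff_sum)
    have K1: "is_subfield {c. c ^ p \<in> K}" by (rule subfield_frob_preimage[OF K])
    have "c i \<in> {c. c ^ p \<in> K}" for i using g(1) by (simp add: c_def s over_coeff)
    then have fK1: "f \<in> over {c. c ^ p \<in> K}"
      unfolding f_def by (intro over_sum[OF K1] over_monom[OF K1])
    have "poly f z ^ p = (\<Sum>i\<le>n div p. (c i * z ^ i) ^ p)"
      using frob_sum[where n = 1] by (simp add: f_def poly_sum poly_monom)
    also have "\<dots> = (\<Sum>i\<le>n div p. coeff g (p * i) * z ^ (p * i))"
      by (simp add: power_mult_distrib c_def s power_mult[symmetric] mult.commute)
    also have "\<dots> = (\<Sum>i\<in>(\<lambda>i. p * i) ` {..n div p}. coeff g i * z ^ i)"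
      by (subst sum.reindex) (use p_pos in \<open>auto simp: inj_on_def\<close>)
    also have "\<dots> = (\<Sum>i\<le>n. coeff g i * z ^ i)"
    proof (rule sum.mono_neutral_left)
      show "(\<lambda>i. p * i) ` {..n div p} \<subseteq> {..n}"
        by (auto simp: less_eq_div_iff_mult_less_eq p_pos mult.commute)
      show "\<forall>i\<in>{..n} - (\<lambda>i. p * i) ` {..n div p}. coeff g i * z ^ i = 0"
      proof
        fix i assume i: "i \<in> {..n} - (\<lambda>i. p * i) ` {..n div p}"
        have "\<not> p dvd i"
        proof
          assume "p dvd i"
          then obtain l where l: "i = p * l" ..
          then have "l \<le> n div p" using i by (simp add: less_eq_div_iff_mult_less_eq p_pos mult.commute)
          with i l show False by blast
        qed
        then show "coeff g i * z ^ i = 0" by (simp add: cz)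
      qed
    qed simp
    also have "\<dots> = 0" using g(3) by (simp add: poly_altdef n_def)
    finally have fz: "poly f z = 0" by simp
    have pn: "p dvd n" using cz[of n] g(2) by (auto simp: n_def)
    have "c (n div p) \<noteq> 0"
    proof
      assume "c (n div p) = 0"
      then have "coeff g (p * (n div p)) = 0" using s p_pos by (metis c_def power_0_left not_gr0)
      then show False using pn g(2) by (simp add: n_def)
    qed
    then have "f \<noteq> 0" using cf by (metis coeff_0 order_refl)
    from desc[OF fK1 this fz] obtain h where h: "h \<in> over K" "h \<noteq> 0" "degree h \<le> degree f" "poly h z = 0"
      by blast
    have "degree f \<le> n div p" by (rule degree_le) (simp add: cf)
    also have "n div p < n" using n p_gt_1 by simp
    finally show False using min[OF h(1,2,4)] h(3) by (simp add: n_def)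
  qed
  \<comment> \<open>The common divisor \<open>d\<close> of \<open>g\<close> and its derivative has
    degree below \<open>n\<close>, so it does not vanish at \<open>z\<close>. Then the cofactor
    \<open>h\<close> does, its degree is already \<open>n\<close>, and \<open>d\<close> is
    constant.\<close>
  obtain u v d h k where bz0: "u \<in> over K" "v \<in> over K"
    and bz: "d \<in> over K" "h \<in> over K" and kK: "k \<in> over K"
    and bz': "d = u * g + v * pderiv g" "d \<noteq> 0" "g = h * d" "pderiv g = k * d"
    using that by (rule over_bezout[OF K g(1) over_pderiv[OF K g(1)] g(2)])
  note bz = bz bz'
  have h0: "h \<noteq> 0" using bz(5) g(2) by (metis mult_zero_left)
  have k0: "k \<noteq> 0" using bz(6) pg by (metis mult_zero_left)
  have "degree (pderiv g) < n"
  proof -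
    have "coeff (pderiv g) i = 0" if "n - 1 < i" for i
      using that by (simp add: coeff_pderiv coeff_eq_0 n_def)
    then have "degree (pderiv g) \<le> n - 1" by (intro degree_le) auto
    then show ?thesis using n by simp
  qed
  moreover have "degree d \<le> degree (pderiv g)" using bz(6) pg by (metis dvd_imp_degree_le dvd_triv_right)
  ultimately have "poly d z \<noteq> 0" using min[OF bz(1,4)] by (auto simp: n_def)
  then have "poly h z = 0" using g(3) bz(5) by (metis mult_eq_0_iff poly_mult)
  then have "degree g \<le> degree h" using min bz(2) h0 by blast
  then have "degree d = 0" using bz(5) degree_mult_eq[OF h0 bz(4)] by (metis add_le_same_cancel1 le_zero_eq)
  then have du: "is_unit d" using bz(4) by (simp add: is_unit_iff_degree)
  have "coprime g (pderiv g)"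
  proof (rule coprimeI)
    fix c assume "c dvd g" "c dvd pderiv g"
    then have "c dvd d" unfolding bz(3) by simp
    then show "is_unit c" using du dvd_trans by blast
  qed
  then show ?thesis
    unfolding separable_over_def using g over_iff_coeffs[of K g] is_subfieldD(1)[OF K] by blast
qed

section \<open>Separability of polynomial expressions in a separable element\<close>

lemma coprime_pderiv_simple:
  assumes "coprime f (pderiv f)" "poly f (z :: 'a) = 0"
  shows "poly (pderiv f) z \<noteq> 0"
proof
  assume "poly (pderiv f) z = 0"
  then have "is_unit [:-z, 1:]" using assms not_coprimeI poly_eq_0_iff_dvd by metis
  then show False by (simp add: is_unit_iff_degree)
qed

text \<open>A nonconstant common divisor would have a root in the ambient field, and that root would
  be multiple.\<close>

lemma simple_coprime_pderiv:
  assumes "(f :: 'a poly) \<noteq> 0" "\<And>z. poly f z = 0 \<Longrightarrow> poly (pderiv f) z \<noteq> 0"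
  shows "coprime f (pderiv f)"
proof (rule coprimeI)
  fix c assume c: "c dvd f" "c dvd pderiv f"
  then have "c \<noteq> 0" using assms by auto
  moreover have "degree c = 0"
  proof (rule ccontr)
    assume "degree c \<noteq> 0"
    then obtain z where "poly c z = 0" using closed unfolding alg_closed_def by blast
    then have "poly f z = 0" "poly (pderiv f) z = 0" using c by (auto elim!: dvdE)
    then show False using assms by blast
  qed
  ultimately show "is_unit c" by (simp add: is_unit_iff_degree)
qed

lemma separable_overI:
  assumes "is_subfield K" "f \<in> over K" "f \<noteq> 0" "poly f y = 0"
    "\<And>z. poly f z = 0 \<Longrightarrow> poly (pderiv f) z \<noteq> 0"
  shows "separable_over K (y :: 'a)"
  unfolding separable_over_def
  using assms simple_coprime_pderiv[of f] over_iff_coeffs[of K f] is_subfieldD(1)[OF assms(1)] by blast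

text \<open>The p-th power raises each coefficient to the p-th power and replaces X by X^p, so it
  carries K^(1/p)[X] into K[X].\<close>

lemma frob_poly_coeffs:
  assumes K: "is_subfield (K :: 'a set)" and f: "f \<in> over {c :: 'a. c ^ p \<in> K}"
  shows "f ^ p \<in> over K"
proof -
  note K1 = subfield_frob_preimage[OF K]
  show ?thesis using f
  proof (induction f)
    case 0
    show ?case using p_pos by (simp add: power_0_left over_0[OF K])
  next
    case (pCons c f)
    have "pCons c f = [:c:] + monom 1 1 * f" by (simp add: monom_Suc)
    then have "pCons c f ^ p = [:c ^ p:] + monom 1 p * f ^ p"
      using frob_add_poly[where n = 1] by (simp add: power_mult_distrib monom_power poly_const_pow)
    moreover have "f \<in> over {c. c ^ p \<in> K}" "c ^ p \<in> K" using pCons.prems over_pCons[OF K1] by auto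
    ultimately show ?case using pCons.IH is_subfieldD(2)[OF K]
      by (auto intro!: over_add[OF K] over_mult[OF K] over_monom[OF K] simp: over_const[OF K])
  qed
qed

text \<open>Because the minimal polynomial of \<open>y\<close> has n distinct roots, 1, y, ...,
  y^(n-1) stay independent over K^(1/p). A relation over K^(1/p) between powers of \<open>z\<close>
  is then a linear system with coefficients in \<open>K\<close>, whose solvability descends to
  \<open>K\<close>; Mac Lane's criterion applies.\<close>

lemma separable_adj:
  assumes K: "is_subfield (K :: 'a set)" and y: "separable_over K y" and z: "z \<in> adj K y"
  shows "separable_over K z"
proof -
  obtain a where a: "a \<in> over K" "z = poly a y" using z by (auto simp: adj_def)
  obtain F where F: "F \<noteq> 0" "F \<in> over K" "poly F y = 0" "coprime F (pderiv F)"
    using y over_iff_coeffs[of K] is_subfieldD(1)[OF K] by (auto simp: separable_over_def)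
  obtain g where g: "g \<in> over K" "g \<noteq> 0" "poly g y = 0"
    and dvd: "\<And>h. h \<in> over K \<Longrightarrow> poly h y = 0 \<Longrightarrow> \<exists>k\<in>over K. h = k * g"
    by (rule over_minpoly[OF K F(2,1,3)], rule that) blast+
  define n where "n = degree g"
  obtain k where k: "F = k * g" using dvd F by blast
  have simple: "poly (pderiv g) w \<noteq> 0" if "poly g w = 0" for w
  proof -
    have "poly F w = 0" using k that by simp
    from coprime_pderiv_simple[OF F(4) this] show ?thesis
      using that by (auto simp: k pderiv_mult)
  qed
  \<comment> \<open>f^p lies over \<open>K\<close> and vanishes at \<open>y\<close>, so
    \<open>g\<close> divides it and \<open>f\<close> vanishes at all \<open>n\<close> roots of
    \<open>g\<close>.\<close>
  have deg: "n \<le> degree f" if f: "f \<in> over {c. c ^ p \<in> K}" "f \<noteq> 0" "poly f y = 0" for f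
  proof -
    have "poly (f ^ p) y = 0" using f p_pos by (simp add: power_0_left)
    then obtain h where "f ^ p = h * g" using dvd frob_poly_coeffs[OF K f(1)] by blast
    then have "poly f w ^ p = poly h w * poly g w" for w by (metis poly_mult poly_power)
    then have "poly f w = 0" if "poly g w = 0" for w
      using that by (metis mult_zero_right power_eq_0_iff)
    then have "{w. poly g w = 0} \<subseteq> {w. poly f w = 0}" by blast
    then have "card {w. poly g w = 0} \<le> card {w. poly f w = 0}"
      using f(2) by (intro card_mono poly_roots_finite)
    also have "\<dots> \<le> degree f" using card_poly_roots_bound[OF f(2)] .
    finally show ?thesis using card_roots_simple[OF g(2) simple] by (simp add: n_def)
  qed
  have "\<exists>v\<in>over K. (v = 0 \<or> degree v < n) \<and> z ^ i = poly v y" for i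
  proof -
    obtain u v where uv: "u \<in> over K" "v \<in> over K" "a ^ i = u * g + v" "v = 0 \<or> degree v < degree g"
      using over_division[OF K over_power[OF K a(1)] g(1,2)] by blast
    have "z ^ i = poly (a ^ i) y" using a by simp
    then have "z ^ i = poly v y" using g(3) uv(3) by simp
    with uv show ?thesis by (auto simp: n_def)
  qed
  then obtain A where A: "\<And>i. A i \<in> over K" "\<And>i. A i = 0 \<or> degree (A i) < n" "\<And>i. z ^ i = poly (A i) y"
    by metis
  \<comment> \<open>Two uses: N = n makes \<open>z\<close> algebraic by counting unknowns, and N =
    degree f transports a given relation from K^(1/p) to \<open>K\<close>.\<close>
  have rel: "\<exists>f\<in>over K. f \<noteq> 0 \<and> degree f \<le> N \<and> poly f z = 0"
    if sol: "n < card {..N} \<or> (\<exists>c. (\<exists>i\<in>{..N}. c i \<noteq> 0) \<and> (\<forall>j<n. (\<Sum>i\<le>N. c i * coeff (A i) j) = 0))" for N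
  proof -
    have AK: "coeff (A i) j \<in> K" for i j using A(1) by (rule over_coeff)
    obtain c where c: "\<forall>i\<in>{..N}. c i \<in> K" "\<exists>i\<in>{..N}. c i \<noteq> 0"
      "\<forall>j<n. (\<Sum>i\<le>N. c i * coeff (A i) j) = 0"
      using linear_system_descent[OF K finite_atMost AK sol] by auto
    define f where "f = (\<Sum>i\<le>N. monom (c i) i)"
    have cf: "coeff f i = (if i \<le> N then c i else 0)" for i by (simp add: f_def coeff_sum)
    have zero: "(\<Sum>i\<le>N. smult (c i) (A i)) = 0"
    proof (rule poly_eqI)
      fix j show "coeff (\<Sum>i\<le>N. smult (c i) (A i)) j = coeff 0 j"
      proof (cases "j < n")
        case True then show ?thesis using c(3) by (simp add: coeff_sum)
      next
        case False
        then have "coeff (A i) j = 0" for i using A(2)[of i] by (auto intro: coeff_eq_0)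
        then show ?thesis by (simp add: coeff_sum)
      qed
    qed
    have "poly f z = (\<Sum>i\<le>N. c i * poly (A i) y)" by (simp add: f_def poly_sum poly_monom A(3))
    also have "\<dots> = poly (\<Sum>i\<le>N. smult (c i) (A i)) y" by (simp add: poly_sum)
    finally have "poly f z = 0" using zero by simp
    moreover have "f \<in> over K" using c(1) is_subfieldD(1)[OF K] by (auto simp: over_def cf)
    moreover have "f \<noteq> 0" using c(2) cf by (metis atMost_iff coeff_0)
    moreover have "degree f \<le> N" by (rule degree_le) (simp add: cf)
    ultimately show ?thesis by blast
  qed
  obtain f0 where f0: "f0 \<in> over K" "f0 \<noteq> 0" "poly f0 z = 0" using rel[of n] by auto
  show ?thesis
  proof (rule separable_MacLane[OF K f0])
    fix f assume f: "f \<in> over {c. c ^ p \<in> K}" "f \<noteq> 0" "poly f z = 0"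
    note K1 = subfield_frob_preimage[OF K]
    have sub: "K \<subseteq> {c. c ^ p \<in> K}" using is_subfieldD(9)[OF K] by blast
    define N where "N = degree f"
    define h where "h = (\<Sum>i\<le>N. smult (coeff f i) (A i))"
    have "h \<in> over {c. c ^ p \<in> K}"
      unfolding h_def using over_mono[OF sub A(1)] over_coeff[OF f(1)]
      by (intro over_sum[OF K1] over_smult[OF K1]) auto
    moreover have "poly h y = 0"
      using f(3) by (simp add: h_def poly_sum A(3)[symmetric] poly_altdef[of f] N_def)
    moreover have "h = 0 \<or> degree h < n"
    proof (cases "n = 0")
      case True
      then have "A i = 0" for i using A(2)[of i] by simp
      then show ?thesis by (simp add: h_def)
    next
      case False
      have "degree (smult (coeff f i) (A i)) < n" for i
      proof -
        have "degree (A i) < n" using A(2)[of i] False by auto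
        then show ?thesis using degree_smult_le le_less_trans by blast
      qed
      then show ?thesis unfolding h_def using False by (intro disjI2 degree_sum_less) auto
    qed
    ultimately have "h = 0" using deg by force
    then have "(\<Sum>i\<le>N. coeff f i * coeff (A i) j) = 0" for j
      by (metis (no_types, lifting) coeff_0 coeff_smult coeff_sum h_def sum.cong)
    moreover have "coeff f N \<noteq> 0" using f(2) by (simp add: N_def)
    ultimately show "\<exists>g\<in>over K. g \<noteq> 0 \<and> degree g \<le> degree f \<and> poly g z = 0"
      using rel[of N] unfolding N_def by blast
  qed
qed

end

section \<open>The inseparable degree\<close>

locale function_field = closed_char_p p ambient
  for p :: nat and ambient :: "'a::field itself" +
  fixes e q :: nat and t :: 'a
  assumes e_pos: "0 < e" and q_eq: "q = p ^ e" and transc: "transcendental_over_Fq q t"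
begin

lemma q_gt_1: "1 < q"
  unfolding q_eq by (rule one_less_power[OF p_gt_1 e_pos])

lemma subfield_Fq: "is_subfield (Fq q :: 'a set)"
  unfolding is_subfield_def Fq_def q_eq
  by (auto simp: frob_0 frob_add frob_diff power_mult_distrib power_inverse)

lemma polyA_eq: "polyA q = (over (Fq q) :: 'a poly set)"
  using over_iff_coeffs[OF is_subfieldD(1)[OF subfield_Fq]] by (auto simp: polyA_def)

lemma transcendental: "a \<in> over (Fq q) \<Longrightarrow> poly a t = 0 \<Longrightarrow> a = 0"
  using transc by (auto simp: transcendental_over_Fq_def polyA_eq)

text \<open>From c = c^(q^n) and q^n = p^((e-1) n) p^n, the root is c^(p^((e-1) n)).\<close>

lemma Fq_frob_root:
  assumes "(c :: 'a) \<in> Fq q"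
  shows "\<exists>d\<in>Fq q. d ^ (p ^ n) = c"
proof
  have iter: "c ^ (q ^ n) = c" for n
    using assms by (induction n) (auto simp: Fq_def power_mult mult.commute[of q])
  have "(e - 1) * n + n = e * n" using e_pos by (cases e) auto
  then have "p ^ ((e - 1) * n) * p ^ n = q ^ n" by (metis power_add power_mult q_eq)
  then show "(c ^ (p ^ ((e - 1) * n))) ^ (p ^ n) = c" by (simp add: power_mult[symmetric] iter)
  show "c ^ (p ^ ((e - 1) * n)) \<in> Fq q" using assms by (intro is_subfieldD[OF subfield_Fq])
qed

section \<open>The rational function field F = F_q(t)\<close>

lemma ratfield_least:
  assumes N: "is_subfield N" "Fq q \<subseteq> N" "t \<in> N"
  shows "ratfield q t \<subseteq> N"
proof -
  have "poly a t \<in> N" if "a \<in> polyA q" for a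
    using that N by (intro over_poly) (auto simp: polyA_eq intro: over_mono)
  then show ?thesis
    unfolding ratfield_def using is_subfieldD(7)[OF N(1)] by blast
qed

lemma ratfieldI: "a \<in> over (Fq q) \<Longrightarrow> b \<in> over (Fq q) \<Longrightarrow> poly b t \<noteq> 0 \<Longrightarrow> x = poly a t / poly b t \<Longrightarrow>
    x \<in> ratfield q t"
  unfolding ratfield_def polyA_eq by blast

lemma ratfieldE:
  assumes "x \<in> ratfield q t"
  obtains a b where "a \<in> over (Fq q)" "b \<in> over (Fq q)" "poly b t \<noteq> 0" "x = poly a t / poly b t"
  using assms unfolding ratfield_def polyA_eq by blast

lemma Fq_ratfield: "c \<in> Fq q \<Longrightarrow> c \<in> ratfield q t"
  by (rule ratfieldI[of "[:c:]" 1]) (auto simp: over_const[OF subfield_Fq] over_1[OF subfield_Fq])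

lemma t_ratfield: "t \<in> ratfield q t"
  by (rule ratfieldI[of "[:0, 1:]" 1])
    (auto simp: over_pCons[OF subfield_Fq] over_0[OF subfield_Fq] over_1[OF subfield_Fq] is_subfieldD[OF subfield_Fq])

lemma subfield_ratfield: "is_subfield (ratfield q t)"
  unfolding is_subfield_def
proof (intro conjI ballI impI)
  note A = over_add[OF subfield_Fq] over_diff[OF subfield_Fq] over_mult[OF subfield_Fq]
  show "0 \<in> ratfield q t" "1 \<in> ratfield q t"
    by (auto intro!: Fq_ratfield is_subfieldD[OF subfield_Fq])
  fix x y assume "x \<in> ratfield q t" "y \<in> ratfield q t"
  then obtain a b c d where *: "a \<in> over (Fq q)" "b \<in> over (Fq q)" "poly b t \<noteq> 0" "x = poly a t / poly b t"
    "c \<in> over (Fq q)" "d \<in> over (Fq q)" "poly d t \<noteq> 0" "y = poly c t / poly d t"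
    by (elim ratfieldE)
  show "x + y \<in> ratfield q t"
    unfolding *(4,8)
    using * by (intro ratfieldI[of "a * d + c * b" "b * d"] A) (simp_all add: add_frac_eq)
  show "x - y \<in> ratfield q t"
    unfolding *(4,8)
    using * by (intro ratfieldI[of "a * d - c * b" "b * d"] A) (simp_all add: diff_frac_eq)
  show "x * y \<in> ratfield q t"
    unfolding *(4,8)
    using * by (intro ratfieldI[of "a * c" "b * d"] A) simp_all
next
  fix x assume "x \<in> ratfield q t" "x \<noteq> 0"
  then obtain a b where "a \<in> over (Fq q)" "b \<in> over (Fq q)" "poly b t \<noteq> 0" "x = poly a t / poly b t"
    by (elim ratfieldE)
  with \<open>x \<noteq> 0\<close> show "inverse x \<in> ratfield q t" by (intro ratfieldI[of b a]) auto
qed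

text \<open>By transcendence the equation of values becomes X b^p = a^p in F_q[X], where the degrees
  differ modulo p.\<close>

lemma t_not_p_power:
  assumes "y \<in> ratfield q t"
  shows "y ^ p \<noteq> t"
proof
  assume y: "y ^ p = t"
  obtain a b where ab: "a \<in> over (Fq q)" "b \<in> over (Fq q)" "poly b t \<noteq> 0" "y = poly a t / poly b t"
    using assms by (rule ratfieldE)
  define f where "f = [:0, 1:] * b ^ p - a ^ p"
  have "f \<in> over (Fq q)"
    unfolding f_def using ab is_subfieldD(1,2)[OF subfield_Fq]
    by (intro over_diff over_mult over_power subfield_Fq) (auto simp: over_pCons[OF subfield_Fq] over_0[OF subfield_Fq])
  moreover have "t * poly b t ^ p = poly a t ^ p"
    using y ab by (simp add: power_divide field_simps)
  then have "poly f t = 0" by (simp add: f_def)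
  ultimately have "f = 0" by (rule transcendental)
  then have eq: "[:0, 1:] * b ^ p = a ^ p" by (simp add: f_def)
  have b0: "b \<noteq> 0" using ab by auto
  then have "[:0, 1:] * b ^ p \<noteq> 0" by simp
  then have a0: "a \<noteq> 0" using eq p_pos by (metis power_0_left not_gr0)
  have "degree ([:0, 1:] * b ^ p) = 1 + p * degree b"
    using b0 by (subst degree_mult_eq) (auto simp: degree_power_eq)
  then have "1 + p * degree b = p * degree a"
    using degree_power_eq[OF a0, of p] by (simp only: eq)
  then have "p dvd 1" by (metis dvd_add_left_iff dvd_triv_left)
  then show False using p_gt_1 by simp
qed

text \<open>F^p[t] is a field containing F_q, which is perfect, and t; so it contains F. Taking p-th
  roots in an expansion of \<open>c\<close> by powers of t gives F^(1/p) = F(\<eta>) with \<eta> =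
  t^(1/p).\<close>

lemma ratfield_p_basis:
  assumes "(c :: 'a) \<in> ratfield q t" "t = \<eta> ^ p"
  obtains d where "d \<in> over (ratfield q t)" "degree d < p" "c = poly d \<eta> ^ p"
proof -
  let ?F = "ratfield q t"
  let ?M = "(\<lambda>x. x ^ p) ` ?F"
  have M: "is_subfield ?M" using subfield_frob_image[OF subfield_ratfield, of 1] by simp
  have tM: "t ^ p \<in> ?M" using t_ratfield by blast
  have "?F \<subseteq> adj ?M t"
  proof (rule ratfield_least)
    show "is_subfield (adj ?M t)" using subfield_adj[OF M, of t 1] tM by simp
    show "t \<in> adj ?M t" by (rule adj_gen[OF M])
    show "Fq q \<subseteq> adj ?M t"
    proof
      fix c :: 'a assume "c \<in> Fq q"
      then obtain d where "d \<in> Fq q" "d ^ p = c" using Fq_frob_root[of c 1] by auto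
      then have "c \<in> ?M" using Fq_ratfield by blast
      then show "c \<in> adj ?M t" by (rule adj_base[OF M])
    qed
  qed
  then have "c \<in> adj ?M t" using assms by blast
  then obtain v where v: "v \<in> over ?M" "degree v < p" "c = poly v t"
    by (rule adj_reduce[OF M tM p_pos])
  have "\<forall>i. \<exists>x\<in>?F. coeff v i = x ^ p" using over_coeff[OF v(1)] by blast
  then obtain s where s: "\<And>i. s i \<in> ?F" "\<And>i. coeff v i = s i ^ p" by metis
  define d where "d = (\<Sum>i\<le>degree v. monom (s i) i)"
  have "d \<in> over ?F"
    unfolding d_def using s(1) by (intro over_sum[OF subfield_ratfield] over_monom[OF subfield_ratfield])
  moreover have "degree d < p"
    unfolding d_def
  proof (rule degree_sum_less[OF _ p_pos])
    fix i assume "i \<in> {..degree v}"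
    then show "degree (monom (s i) i) < p" using degree_monom_le[of "s i" i] v(2) by auto
  qed
  moreover have "poly d \<eta> ^ p = (\<Sum>i\<le>degree v. (s i * \<eta> ^ i) ^ p)"
    using frob_sum[where n = 1] by (simp add: d_def poly_sum poly_monom)
  then have "poly d \<eta> ^ p = c"
    using v(3) by (simp add: power_mult_distrib s(2)[symmetric] assms(2) poly_altdef
        mult.commute flip: power_mult)
  ultimately show ?thesis using that by blast
qed

end

locale function_field_ext = function_field p ambient e q t
  for p :: nat and ambient :: "'a::field itself" and e q :: nat and t :: 'a +
  fixes K :: "'a set"
  assumes subfield_K: "is_subfield K" and ratfield_K: "ratfield q t \<subseteq> K"
    and findim_K: "findim_over (ratfield q t) K"
begin

text \<open>The uniformity of \<open>N\<close> in \<open>x\<close> is the point: it limits the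
  orders of the p-power roots of t in \<open>K\<close>.\<close>

lemma algebraic_bounded:
  obtains N where "\<And>x. x \<in> K \<Longrightarrow> \<exists>f\<in>over (ratfield q t). f \<noteq> 0 \<and> degree f \<le> N \<and> poly f x = 0"
proof -
  obtain xs where "span_over (ratfield q t) xs = K" using findim_K by (auto simp: findim_over_def)
  then have "\<exists>f\<in>over (ratfield q t). f \<noteq> 0 \<and> degree f \<le> length xs \<and> poly f x = 0" if "x \<in> K" for x
    using that is_subfieldD(9)[OF subfield_K] by (intro annihilator_of_span[OF subfield_ratfield]) auto
  then show ?thesis using that by blast
qed

text \<open>Since t is not a p-th power in F, a p^n-th root of t satisfies no equation over F of
  degree below p^n; the uniform bound therefore limits n.\<close>

lemma maximal_root_of_t:
  obtains m \<theta> where "\<theta> \<in> K" "\<theta> ^ (p ^ m) = t" "\<And>n y. y \<in> K \<Longrightarrow> y ^ (p ^ n) = t \<Longrightarrow> n \<le> m"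
proof -
  define E where "E = {n. \<exists>y\<in>K. y ^ (p ^ n) = t}"
  obtain N where N: "\<And>x. x \<in> K \<Longrightarrow> \<exists>f\<in>over (ratfield q t). f \<noteq> 0 \<and> degree f \<le> N \<and> poly f x = 0"
    using algebraic_bounded by blast
  have "n \<le> N" if n: "n \<in> E" for n
  proof (rule ccontr)
    assume "\<not> n \<le> N"
    obtain y where y: "y \<in> K" "y ^ (p ^ n) = t" using n by (auto simp: E_def)
    obtain f where f: "f \<in> over (ratfield q t)" "f \<noteq> 0" "degree f \<le> N" "poly f y = 0" using N y by blast
    \<comment> \<open>Such an element, raised to the power p^(n - Suc j), would be a p-th root of t
      in F.\<close>
    have "y ^ (p ^ j) \<notin> ratfield q t" if "j < n" for j
    proof
      assume "y ^ (p ^ j) \<in> ratfield q t"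
      then have "(y ^ (p ^ j)) ^ (p ^ (n - Suc j)) \<in> ratfield q t"
        by (rule is_subfieldD[OF subfield_ratfield])
      moreover have "p ^ j * (p ^ (n - Suc j) * p) = p ^ n"
      proof -
        have "p ^ (n - Suc j) * p = p ^ (n - j)"
          using that by (metis Suc_diff_Suc power_Suc2)
        then show ?thesis using that by (metis le_add_diff_inverse less_imp_le power_add)
      qed
      then have "((y ^ (p ^ j)) ^ (p ^ (n - Suc j))) ^ p = t"
        by (simp add: y(2) mult.assoc flip: power_mult)
      ultimately show False using t_not_p_power by blast
    qed
    moreover have "N < p ^ n"
      using \<open>\<not> n \<le> N\<close> power_gt_expt[of p n] p_gt_1 by simp
    ultimately have "f = 0"
      using purely_insep_independent[OF subfield_ratfield, of y n f] f y t_ratfield by simp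
    with f show False by simp
  qed
  then have fin: "finite E" by (meson finite_nat_set_iff_bounded_le)
  have "0 \<in> E" using t_ratfield ratfield_K by (auto simp: E_def)
  then have "Max E \<in> E" using fin Max_in by blast
  then show ?thesis using that Max_ge[OF fin] by (auto simp: E_def)
qed

text \<open>If m is maximal with t in the field of p^m-th powers L of K, then t is a p-basis of L over the
  p-th powers of L; by Mac Lane's criterion L is separable over F, and it is the separable closure.\<close>
lemma insep_degree_eq:
  obtains m \<theta> where "\<theta> \<in> K" "\<theta> ^ (p ^ m) = t" "insep_degree q t K = p ^ m"
proof -
  let ?F = "ratfield q t"
  obtain m \<theta> where \<theta>: "\<theta> \<in> K" "\<theta> ^ (p ^ m) = t"
    and max: "\<And>n y. y \<in> K \<Longrightarrow> y ^ (p ^ n) = t \<Longrightarrow> n \<le> m"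
    using that by (rule maximal_root_of_t)
  define L where "L = (\<lambda>x. x ^ (p ^ m)) ` K"
  have L: "is_subfield L" unfolding L_def by (rule subfield_frob_image[OF subfield_K])
  have LK: "L \<subseteq> K" unfolding L_def using is_subfieldD(9)[OF subfield_K] by blast
  have tL: "t \<in> L" unfolding L_def using \<theta> by blast
  have FqK: "Fq q \<subseteq> K" using Fq_ratfield ratfield_K by blast
  have FqL: "Fq q \<subseteq> L"
    unfolding L_def using Fq_frob_root[of _ m] FqK by blast
  have FL: "?F \<subseteq> L" by (rule ratfield_least[OF L FqL tL])
  have sepL: "separable_over ?F x" if x: "x \<in> L" for x
  proof -
    obtain f0 where f0: "f0 \<in> over ?F" "f0 \<noteq> 0" "poly f0 x = 0"
      using algebraic_bounded x LK by (metis subsetD)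
    show ?thesis
    proof (rule separable_MacLane[OF subfield_ratfield f0])
      fix f assume f: "f \<in> over {c. c ^ p \<in> ?F}" "f \<noteq> 0" "poly f x = 0"
      obtain \<eta> where \<eta>: "t = \<eta> ^ p" using frob_root_exists[of 1 t] by auto
      have "\<exists>d\<in>over ?F. degree d < p \<and> coeff f i = poly d \<eta>" for i
      proof -
        have "coeff f i ^ p \<in> ?F" using over_coeff[OF f(1)] by blast
        then obtain d where "d \<in> over ?F" "degree d < p" "coeff f i ^ p = poly d \<eta> ^ p"
          using ratfield_p_basis[OF _ \<eta>] by blast
        then show ?thesis using frob_eq_iff[of "coeff f i" 1] by auto
      qed
      then obtain d where d: "\<And>i. d i \<in> over ?F" "\<And>i. degree (d i) < p" "\<And>i. coeff f i = poly (d i) \<eta>"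
        by metis
      define N where "N = degree f"
      \<comment> \<open>\<open>f\<close> is regrouped by powers of \<eta>: it is the sum of the
        \<open>h l\<close> times \<eta>^l. Inserting x and reading the result as a polynomial in
        \<eta> over \<open>L\<close> gives \<open>w\<close>.\<close>
      define h where "h l = (\<Sum>i\<le>N. monom (coeff (d i) l) i)" for l
      have hF: "h l \<in> over ?F" for l
        unfolding h_def using over_coeff[OF d(1)]
        by (intro over_sum[OF subfield_ratfield] over_monom[OF subfield_ratfield])
      define w where "w = (\<Sum>l<p. monom (poly (h l) x) l)"
      have cw: "coeff w l = (if l < p then poly (h l) x else 0)" for l
        by (simp add: w_def coeff_sum)
      have "w \<in> over L"
        unfolding w_def using over_mono[OF FL hF] x
        by (intro over_sum[OF L] over_monom[OF L] over_poly[OF L])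
      moreover have "degree w < p"
        unfolding w_def
      proof (rule degree_sum_less[OF _ p_pos])
        fix l assume "l \<in> {..<p}"
        then show "degree (monom (poly (h l) x) l) < p" using degree_monom_le le_less_trans by blast
      qed
      moreover have "poly w \<eta> = 0"
      proof -
        have dp: "poly (d i) \<eta> = (\<Sum>l<p. coeff (d i) l * \<eta> ^ l)" for i
          unfolding poly_altdef
          by (rule sum.mono_neutral_left) (use d(2)[of i] in \<open>auto simp: coeff_eq_0\<close>)
        have "poly w \<eta> = (\<Sum>l<p. \<Sum>i\<le>N. coeff (d i) l * x ^ i * \<eta> ^ l)"
          by (simp add: w_def poly_sum poly_monom h_def sum_distrib_right)
        also have "\<dots> = (\<Sum>i\<le>N. (\<Sum>l<p. coeff (d i) l * \<eta> ^ l) * x ^ i)"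
          by (subst sum.swap) (simp add: sum_distrib_right sum_distrib_left mult_ac)
        also have "\<dots> = poly f x" by (simp add: dp[symmetric] d(3)[symmetric] poly_altdef[of f] N_def)
        finally show ?thesis using f(3) by simp
      qed
      \<comment> \<open>Maximality of \<open>m\<close> enters here: \<eta> in \<open>L\<close> would
        give t a root of order p^(m+1) in \<open>K\<close>.\<close>
      moreover have "\<eta> \<notin> L"
      proof
        assume "\<eta> \<in> L"
        then obtain y where "y \<in> K" "\<eta> = y ^ (p ^ m)" by (auto simp: L_def)
        then have "y ^ (p ^ Suc m) = t" by (simp add: \<eta> mult.commute flip: power_mult)
        then show False using max[of y "Suc m"] \<open>y \<in> K\<close> by simp
      qed
      ultimately have "w = 0"
        using purely_insep_independent[OF L, of \<eta> 1 w] tL \<eta> by simp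
      then have hz: "poly (h l) x = 0" if "l < p" for l
        using cw[of l] that by simp
      have "coeff f N \<noteq> 0" using f(2) by (simp add: N_def)
      then have "d N \<noteq> 0" using d(3)[of N] by auto
      \<comment> \<open>The leading coefficient of \<open>f\<close> has a nonzero expansion
        \<open>d N\<close>; any index with nonzero coefficient there makes \<open>h l\<close>
        nonzero, and the top one is chosen.\<close>
      define l where "l = degree (d N)"
      have "l < p" using d(2) by (simp add: l_def)
      have ch: "coeff (h l) i = (if i \<le> N then coeff (d i) l else 0)" for i
        by (simp add: h_def coeff_sum)
      have "coeff (h l) N \<noteq> 0" using \<open>d N \<noteq> 0\<close> unfolding ch by (simp add: l_def)
      then have "h l \<noteq> 0" by auto
      moreover have "degree (h l) \<le> degree f" by (rule degree_le) (simp add: ch N_def)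
      ultimately show "\<exists>g\<in>over ?F. g \<noteq> 0 \<and> degree g \<le> degree f \<and> poly g x = 0"
        using hF hz[OF \<open>l < p\<close>] by blast
    qed
  qed
  have "sep_closure_in ?F K = L"
  proof
    show "L \<subseteq> sep_closure_in ?F K" using sepL LK by (auto simp: sep_closure_in_def)
    \<comment> \<open>Every element of \<open>K\<close> has its p^m-th power in \<open>L\<close>, so
      a separable one already lies in \<open>L\<close>.\<close>
    show "sep_closure_in ?F K \<subseteq> L"
      using separable_purely_insep_mem[OF L FL is_subfieldD(1)[OF subfield_ratfield], of _ m]
      by (auto simp: sep_closure_in_def L_def)
  qed
  then have deg: "insep_degree q t K = degree_over L K" by (simp add: insep_degree_def)
  \<comment> \<open>If this power of \<theta> were y^(p^m), then y would be a root of t of order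
    p^(2m - j), beyond the maximal p^m.\<close>
  have \<theta>_notin: "\<theta> ^ (p ^ j) \<notin> L" if "j < m" for j
  proof
    assume "\<theta> ^ (p ^ j) \<in> L"
    then obtain y where y: "y \<in> K" "\<theta> ^ (p ^ j) = y ^ (p ^ m)" by (auto simp: L_def)
    have "y ^ (p ^ (m + (m - j))) = (y ^ (p ^ m)) ^ (p ^ (m - j))"
      by (simp add: power_add power_mult)
    also have "\<dots> = \<theta> ^ (p ^ (j + (m - j)))"
      by (simp add: y(2)[symmetric] power_add power_mult)
    also have "\<dots> = t" using that \<theta> by simp
    finally show False using max[OF y(1)] that by fastforce
  qed
  have indep: "f = 0" if "f \<in> over L" "poly f \<theta> = 0" "degree f < p ^ m" for f
    using purely_insep_independent[OF L _ \<theta>_notin that] \<theta> tL by simp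
  have lower: "p ^ m \<le> length xs" if xs: "span_over L xs = K" for xs
  proof (rule ccontr)
    assume "\<not> ?thesis"
    moreover obtain f where "f \<in> over L" "f \<noteq> 0" "degree f \<le> length xs" "poly f \<theta> = 0"
      using annihilator_of_span[OF L, of xs \<theta>] xs is_subfieldD(9)[OF subfield_K \<theta>(1)] by blast
    ultimately show False using indep[of f] by force
  qed
  define xs where "xs = map (\<lambda>i. \<theta> ^ i) [0..<p ^ m]"
  have len: "length xs = p ^ m" by (simp add: xs_def)
  have nth: "xs ! i = \<theta> ^ i" if "i < p ^ m" for i using that by (simp add: xs_def)
  have xsK: "set xs \<subseteq> K" using is_subfieldD(9)[OF subfield_K \<theta>(1)] by (auto simp: xs_def)
  have span: "span_over L xs = K"
  proof
    show "span_over L xs \<subseteq> K"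
    proof
      fix x assume "x \<in> span_over L xs"
      then obtain c where c: "x = (\<Sum>i<length xs. c i * xs ! i)" "\<And>i. i < length xs \<Longrightarrow> c i \<in> L"
        by (auto simp: span_over_def)
      have "c i * xs ! i \<in> K" if "i < length xs" for i
        using that c(2) LK xsK nth_mem by (intro is_subfieldD(5)[OF subfield_K]) blast+
      then show "x \<in> K" unfolding c(1) by (intro subfield_sum[OF subfield_K]) auto
    qed
    show "K \<subseteq> span_over L xs"
    proof
      fix x assume x: "x \<in> K"
      \<comment> \<open>\<open>M\<close> consists of the p^(2m)-th powers of elements of
        \<open>K\<close>. The goal is L = M[t], whose p^m-th roots give K = L[\<theta>]. It holds
        because elements of \<open>L\<close> are separable over F, which lies in M[t], and have
        their p^m-th powers in \<open>M\<close>.\<close>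
      define M where "M = (\<lambda>x. x ^ (p ^ m)) ` L"
      have M: "is_subfield M" unfolding M_def by (rule subfield_frob_image[OF L])
      have tM: "t ^ (p ^ m) \<in> M" using tL by (auto simp: M_def)
      note N = subfield_adj[OF M tM]
      have FqN: "Fq q \<subseteq> adj M t"
      proof
        fix c :: 'a assume "c \<in> Fq q"
        then obtain d where "d \<in> Fq q" "d ^ (p ^ m) = c" using Fq_frob_root[of c m] by auto
        then have "c \<in> M" using FqL by (auto simp: M_def)
        then show "c \<in> adj M t" by (rule adj_base[OF M])
      qed
      have FN: "?F \<subseteq> adj M t" by (rule ratfield_least[OF N FqN adj_gen[OF M]])
      have xL: "x ^ (p ^ m) \<in> L" using x by (auto simp: L_def)
      have "x ^ (p ^ m) \<in> adj M t"
      proof (rule separable_purely_insep_mem[OF N FN is_subfieldD(1)[OF subfield_ratfield] sepL[OF xL]])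
        have "(x ^ (p ^ m)) ^ (p ^ m) \<in> M" using xL by (simp add: M_def)
        then show "(x ^ (p ^ m)) ^ (p ^ m) \<in> adj M t" by (rule adj_base[OF M])
      qed
      then obtain v where v: "v \<in> over M" "degree v < p ^ m" "x ^ (p ^ m) = poly v t"
        using that p_pos by (elim adj_reduce[OF M tM, rotated]) auto
      have "\<forall>i. \<exists>c\<in>L. coeff v i = c ^ (p ^ m)" using over_coeff[OF v(1)] by (auto simp: M_def)
      then obtain c where c: "\<And>i. c i \<in> L" "\<And>i. coeff v i = c i ^ (p ^ m)" by metis
      have "(\<Sum>i<p ^ m. c i * \<theta> ^ i) ^ (p ^ m) = (\<Sum>i<p ^ m. coeff v i * t ^ i)"
        by (simp add: frob_sum power_mult_distrib c(2) \<theta>(2)[symmetric] mult.commute flip: power_mult)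
      also have "\<dots> = poly v t"
        unfolding poly_altdef
        by (rule sum.mono_neutral_right) (use v(2) in \<open>auto simp: coeff_eq_0\<close>)
      finally have "x = (\<Sum>i<p ^ m. c i * \<theta> ^ i)" using v(3) by (metis frob_eq_iff)
      also have "\<dots> = (\<Sum>i<length xs. c i * xs ! i)"
        unfolding len by (rule sum.cong) (auto simp: nth)
      finally show "x \<in> span_over L xs" using c(1) by (auto simp: span_over_def)
    qed
  qed
  have "degree_over L K = p ^ m"
    unfolding degree_over_def
  proof (rule Least_equality)
    show "\<exists>xs. length xs = p ^ m \<and> set xs \<subseteq> K \<and> span_over L xs = K" using len xsK span by blast
    show "p ^ m \<le> n" if "\<exists>xs. length xs = n \<and> set xs \<subseteq> K \<and> span_over L xs = K" for n
      using that lower by blast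
  qed
  then show ?thesis using that \<theta> deg by metis
qed

lemma root_of_t:
  assumes "r dvd insep_degree q t K"
  obtains j \<theta> where "r = p ^ j" "\<theta> \<in> K" "\<theta> ^ r = t"
proof -
  obtain m \<theta> where \<theta>: "\<theta> \<in> K" "\<theta> ^ (p ^ m) = t" "insep_degree q t K = p ^ m"
    by (rule insep_degree_eq)
  then obtain j where j: "j \<le> m" "r = p ^ j"
    using assms divides_primepow_nat[OF prime_p] by auto
  have "(\<theta> ^ (p ^ (m - j))) ^ r = t"
    using \<theta>(2) j by (simp flip: power_mult power_add)
  then show ?thesis using that[of j "\<theta> ^ (p ^ (m - j))"] j is_subfieldD(9)[OF subfield_K \<theta>(1)] by blast
qed

end

section \<open>Drinfeld modules\<close>

context function_field
begin

section \<open>The action of A through a Drinfeld module\<close>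

lemma phi_t_add: "phi_t q r c (x + y :: 'a) = phi_t q r c x + phi_t q r c y"
  by (simp add: phi_t_def q_eq frob_add distrib_left sum.distrib flip: power_mult)

lemma Fq_power: "a \<in> Fq q \<Longrightarrow> (a :: 'a) ^ (q ^ n) = a"
  by (induction n) (auto simp: Fq_def power_mult mult.commute[of q])

lemma phi_t_Fq: "a \<in> Fq q \<Longrightarrow> phi_t q r c (a * x :: 'a) = a * phi_t q r c x"
  by (simp add: phi_t_def power_mult_distrib Fq_power sum_distrib_left mult_ac)

lemma phi_act_0: "phi_act q r c 0 x = 0"
  by (simp add: phi_act_def)

text \<open>This is \<phi>_{a + t f} = a + \<phi>_f \<phi>_t; the inductions below run along this
  Horner scheme.\<close>

lemma phi_act_pCons: "phi_act q r c (pCons a f) x = a * x + phi_act q r c f (phi_t q r c x)"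
proof (cases "f = 0")
  case False
  then show ?thesis
    by (simp only: phi_act_def degree_pCons_eq[OF False] sum.atMost_Suc_shift coeff_pCons_0
        coeff_pCons_Suc funpow_Suc_right o_apply funpow_0)
qed (simp add: phi_act_def)

lemma phi_act_add: "phi_act q r c f (x + y :: 'a) = phi_act q r c f x + phi_act q r c f y"
  by (induction f arbitrary: x y) (simp_all add: phi_act_0 phi_act_pCons phi_t_add algebra_simps)

lemma phi_act_zero: "phi_act q r c f (0 :: 'a) = 0"
  by (metis phi_act_add add.right_neutral add_cancel_right_right)

lemma phi_act_diff: "phi_act q r c f (x - y :: 'a) = phi_act q r c f x - phi_act q r c f y"
  using phi_act_add[of r c f "x - y" y] by simp

text \<open>\<phi>_t is F_q-linear, so it commutes with the scalars of \<open>f\<close>; it would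
  not commute with arbitrary ones.\<close>

lemma phi_act_phi_t:
  "f \<in> over (Fq q) \<Longrightarrow> phi_act q r c f (phi_t q r c (x :: 'a)) = phi_t q r c (phi_act q r c f x)"
proof (induction f arbitrary: x)
  case 0
  show ?case unfolding phi_act_0 by (metis phi_t_add add.right_neutral add_cancel_right_right)
next
  case (pCons a f)
  then show ?case by (simp add: phi_act_pCons phi_t_add phi_t_Fq over_pCons[OF subfield_Fq])
qed

lemma phi_act_plus: "phi_act q r c (f + g) (x :: 'a) = phi_act q r c f x + phi_act q r c g x"
  by (induction f g arbitrary: x rule: poly_induct2) (simp_all add: phi_act_0 phi_act_pCons algebra_simps)

lemma phi_act_smult: "phi_act q r c (smult a f) (x :: 'a) = a * phi_act q r c f x"
  by (induction f arbitrary: x) (simp_all add: phi_act_0 phi_act_pCons algebra_simps)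

lemma phi_act_minus: "phi_act q r c (f - g) (x :: 'a) = phi_act q r c f x - phi_act q r c g x"
  using phi_act_plus[of r c "f - g" g x] by simp

lemma phi_act_1: "phi_act q r c 1 (x :: 'a) = x"
  by (simp add: phi_act_def)

lemma phi_act_mult:
  "f \<in> over (Fq q) \<Longrightarrow> g \<in> over (Fq q) \<Longrightarrow>
    phi_act q r c (f * g) (x :: 'a) = phi_act q r c f (phi_act q r c g x)"
proof (induction f arbitrary: x)
  case (pCons a f)
  then show ?case
    by (simp add: over_pCons[OF subfield_Fq] mult_pCons_left phi_act_plus phi_act_smult phi_act_pCons
        phi_act_phi_t)
qed (simp add: phi_act_0)

lemma phi_act_monom_mult:
  "phi_act q r c (monom 1 n * f) (x :: 'a) = phi_act q r c f ((phi_t q r c ^^ n) x)"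
proof (induction n arbitrary: x)
  case (Suc n)
  have "monom 1 (Suc n) * f = pCons 0 (monom 1 n * f)" by (simp add: monom_Suc)
  then show ?case using Suc by (simp add: phi_act_pCons funpow_swap1)
qed simp

text \<open>\<phi>_f as an ordinary polynomial, built by P \<mapsto> a X + P(T) with T representing
  \<phi>_t. Only the linear term survives differentiation in characteristic p; the constant
  derivative gives separability of torsion, the degree its size.\<close>

lemma phi_act_poly:
  assumes M: "is_subfield M" and c: "\<And>i. i \<le> r \<Longrightarrow> c i \<in> M" "c r \<noteq> 0" "0 < r"
    and f: "f \<in> over (M :: 'a set)"
  shows "\<exists>P\<in>over M. (\<forall>x. poly P x = phi_act q r c f x) \<and> pderiv P = [:poly f (c 0):] \<and>
    (if f = 0 then P = 0 else degree P = q ^ (r * degree f))"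
proof -
  define T where "T = (\<Sum>i\<le>r. monom (c i) (q ^ i))"
  have T: "T \<in> over M" unfolding T_def using c by (intro over_sum[OF M] over_monom[OF M]) auto
  have Tx: "poly T x = phi_t q r c x" for x by (simp add: T_def phi_t_def poly_sum poly_monom)
  obtain r' where r': "r = Suc r'" using c(3) by (cases r) auto
  have "degree (\<Sum>i\<le>r'. monom (c i) (q ^ i)) < q ^ r"
  proof (rule degree_sum_less)
    fix i assume "i \<in> {..r'}"
    then have "q ^ i < q ^ r" using q_gt_1 r' by (intro power_strict_increasing) auto
    then show "degree (monom (c i) (q ^ i)) < q ^ r" using degree_monom_le le_less_trans by blast
  qed (use q_gt_1 in simp)
  then have dT: "degree T = q ^ r"
    unfolding T_def r' using c(2) r' by (simp add: degree_add_eq_right degree_monom_eq)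
  have "CHAR('a) dvd q" using e_pos by (simp add: CHAR_p q_eq)
  then have "(of_nat (q ^ Suc i) :: 'a) = 0" for i by (simp add: of_nat_eq_0_iff_char_dvd)
  then have pdi: "pderiv (monom (c (Suc i)) (q ^ Suc i)) = 0" for i
    unfolding pderiv_monom by simp
  have "pderiv T = pderiv (monom (c 0) 1 + (\<Sum>i\<le>r'. monom (c (Suc i)) (q ^ Suc i)))"
    by (simp only: T_def r' sum.atMost_Suc_shift power_0)
  also have "\<dots> = pderiv (monom (c 0) 1)"
    using higher_pderiv_sum[of 1 "\<lambda>i. monom (c (Suc i)) (q ^ Suc i)" "{..r'}"]
    by (simp add: pderiv_add pdi del: power_Suc)
  also have "\<dots> = [:c 0:]" by (simp add: pderiv_monom monom_0)
  finally have pT: "pderiv T = [:c 0:]" .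
  show ?thesis using f
  proof (induction f)
    case 0
    show ?case by (intro bexI[of _ 0]) (auto simp: phi_act_0 over_0[OF M])
  next
    case (pCons a f)
    have aM: "a \<in> M" "f \<in> over M" using pCons.prems over_pCons[OF M] by auto
    then obtain P where P: "P \<in> over M" "\<And>x. poly P x = phi_act q r c f x"
      "pderiv P = [:poly f (c 0):]" "if f = 0 then P = 0 else degree P = q ^ (r * degree f)"
      using pCons.IH by blast
    define Q where "Q = [:0, a:] + pcompose P T"
    have "Q \<in> over M"
      unfolding Q_def using aM P(1) T is_subfieldD(1)[OF M]
      by (intro over_add[OF M] over_pcompose[OF M]) (auto simp: over_pCons[OF M] over_0[OF M])
    moreover have "poly Q x = phi_act q r c (pCons a f) x" for x
      by (simp add: Q_def poly_pcompose P(2) Tx phi_act_pCons)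
    moreover have "pderiv Q = [:poly (pCons a f) (c 0):]"
      by (simp add: Q_def pderiv_add pderiv_pCons pderiv_pcompose P(3) pT)
    moreover have "degree Q = q ^ (r * degree (pCons a f))"
    proof (cases "f = 0")
      case True
      then show ?thesis using P(4) pCons.hyps by (simp add: Q_def)
    next
      case False
      then have "degree (pcompose P T) = q ^ (r * Suc (degree f))"
        using P(4) by (simp add: degree_pcompose dT power_add)
      moreover have "1 < q ^ (r * Suc (degree f))" using q_gt_1 c(3) by (intro one_less_power) auto
      moreover have "degree [:0, a:] \<le> 1" by simp
      ultimately show ?thesis using False
        unfolding Q_def by (subst degree_add_eq_right) auto
    qed
    ultimately show ?case using pCons.hyps by (intro bexI[of _ Q]) auto
  qed
qed

text \<open>The representing polynomial has a nonzero constant derivative, so its roots are simple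
  and as many as its degree.\<close>

lemma card_phi_kernel:
  assumes "c r \<noteq> 0" "0 < r" "poly f (c 0) \<noteq> 0"
  shows "card {y :: 'a. phi_act q r c f y = 0} = q ^ (r * degree f)"
proof -
  have U: "is_subfield (UNIV :: 'a set)" by (auto simp: is_subfield_def)
  obtain P where P: "\<And>x. poly P x = phi_act q r c f x" "pderiv P = [:poly f (c 0):]"
    "if f = 0 then P = 0 else degree P = q ^ (r * degree f)"
    using phi_act_poly[OF U, of r c f] assms by (auto simp: over_def)
  have "P \<noteq> 0" using P(2) assms by auto
  moreover have "f \<noteq> 0" using assms by auto
  ultimately show ?thesis using card_roots_simple[of P] P assms by simp
qed

lemma separable_phi_kernel:
  assumes M: "is_subfield M" and c: "\<And>i. i \<le> r \<Longrightarrow> c i \<in> M" "c r \<noteq> 0" "0 < r"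
    and f: "f \<in> over (M :: 'a set)" "poly f (c 0) \<noteq> 0" and y: "phi_act q r c f y = 0"
  shows "separable_over M y"
proof -
  obtain P where P: "P \<in> over M" "\<And>x. poly P x = phi_act q r c f x" "pderiv P = [:poly f (c 0):]"
    using phi_act_poly[where r = r and c = c, OF M c f(1)] by blast
  then have "P \<noteq> 0" using f by auto
  then show ?thesis using separable_overI[OF M P(1)] P f y by simp
qed

section \<open>The module (\<theta> + \<tau>)^r and its comparison with the Carlitz module\<close>

abbreviation carlitz_coeff :: "nat \<Rightarrow> 'a" where
  "carlitz_coeff \<equiv> \<lambda>i. if i = 0 then t else 1"

lemma phi_t_carlitz: "phi_t q 1 carlitz_coeff x = t * x + x ^ q"
  by (simp add: phi_t_def)

text \<open>The coefficients of (\<theta> + \<tau>)^n, where \<tau> c = c^q \<tau>.\<close>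
fun twisted_power_coeff :: "'a \<Rightarrow> nat \<Rightarrow> nat \<Rightarrow> 'a" where
  "twisted_power_coeff \<theta> 0 i = (if i = 0 then 1 else 0)"
| "twisted_power_coeff \<theta> (Suc n) i = \<theta> * twisted_power_coeff \<theta> n i +
    (if i = 0 then 0 else twisted_power_coeff \<theta> n (i - 1) ^ q)"

lemma twisted_power_coeff_simps:
  "n < i \<Longrightarrow> twisted_power_coeff \<theta> n i = 0"
  "twisted_power_coeff \<theta> n n = 1" "twisted_power_coeff \<theta> n 0 = \<theta> ^ n"
proof -
  show *: "n < i \<Longrightarrow> twisted_power_coeff \<theta> n i = 0" for n i
    using q_gt_1 by (induction n arbitrary: i) (auto simp: power_0_left)
  show "twisted_power_coeff \<theta> n n = 1" by (induction n) (auto simp: *)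
  show "twisted_power_coeff \<theta> n 0 = \<theta> ^ n" by (induction n) auto
qed

text \<open>Kept general in \<open>R\<close> because it serves twice: for the field
  \<open>K\<close>, and for the valuation ring of a place when good reduction is checked.\<close>

lemma twisted_power_coeff_closed:
  assumes "0 \<in> R" "1 \<in> R" "\<theta> \<in> R" "\<And>x y. x \<in> R \<Longrightarrow> y \<in> R \<Longrightarrow> x + y \<in> R"
    "\<And>x y. x \<in> R \<Longrightarrow> y \<in> R \<Longrightarrow> x * y \<in> R"
  shows "twisted_power_coeff \<theta> n i \<in> R"
proof -
  have "x ^ k \<in> R" if "x \<in> R" for x k by (induction k) (use assms that in auto)
  then show ?thesis by (induction n arbitrary: i) (auto intro!: assms)
qed

text \<open>The recursion for the coefficients is left multiplication by \<theta> + \<tau>, that is,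
  one more application of x \<mapsto> \<theta> x + x^q on the outside.\<close>

lemma phi_t_twisted_power:
  "phi_t q n (twisted_power_coeff \<theta> n) x = ((\<lambda>x. \<theta> * x + x ^ q) ^^ n) x"
proof (induction n)
  case 0
  show ?case by (simp add: phi_t_def)
next
  case (Suc n)
  let ?c = "twisted_power_coeff \<theta>"
  have frob_q: "(sum f I) ^ q = (\<Sum>i\<in>I. f i ^ q)" for f :: "nat \<Rightarrow> 'a" and I
    unfolding q_eq by (rule frob_sum)
  have "phi_t q (Suc n) (?c (Suc n)) x = (\<Sum>i\<le>Suc n. \<theta> * ?c n i * x ^ (q ^ i)) +
      (\<Sum>i\<le>Suc n. (if i = 0 then 0 else ?c n (i - 1) ^ q) * x ^ (q ^ i))"
    by (simp only: phi_t_def twisted_power_coeff.simps distrib_right sum.distrib)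
  also have "(\<Sum>i\<le>Suc n. \<theta> * ?c n i * x ^ (q ^ i)) = \<theta> * phi_t q n (?c n) x"
    by (simp add: twisted_power_coeff_simps phi_t_def sum_distrib_left mult.assoc)
  also have "(\<Sum>i\<le>Suc n. (if i = 0 then 0 else ?c n (i - 1) ^ q) * x ^ (q ^ i)) =
      (\<Sum>i\<le>n. (?c n i * x ^ (q ^ i)) ^ q)"
    by (subst sum.atMost_Suc_shift) (simp add: power_mult_distrib mult.commute flip: power_mult)
  also have "\<dots> = phi_t q n (?c n) x ^ q" by (simp add: phi_t_def frob_q)
  finally show ?case by (simp add: Suc)
qed

text \<open>From (\<theta> x + x^q)^r = t x^r + (x^r)^q, r-th powers intertwine \<phi>_t with
  C_{t^r}. A scalar a becomes a^r, and additivity of r-th powers of polynomials assembles the terms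
  into f^r.\<close>

lemma phi_act_twisted_power:
  assumes r: "r = p ^ j" and \<theta>: "\<theta> ^ r = t"
  shows "phi_act q r (twisted_power_coeff \<theta> r) f y ^ r = carlitz_act q t (f ^ r) (y ^ r)"
proof -
  let ?L = "\<lambda>x. \<theta> * x + x ^ q" and ?C = "phi_t q 1 carlitz_coeff"
  have "?L x ^ r = ?C (x ^ r)" for x
    unfolding phi_t_carlitz
    by (simp add: r frob_add power_mult_distrib \<theta>[unfolded r] mult.commute flip: power_mult)
  then have iter: "((?L ^^ n) x) ^ r = (?C ^^ n) (x ^ r)" for n x
    by (induction n) simp_all
  have r0: "0 < r" using r p_pos by simp
  show ?thesis
    unfolding carlitz_act_def
  proof (induction f arbitrary: y)
    case 0
    show ?case using r0 by (simp add: phi_act_0 power_0_left)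
  next
    case (pCons a f)
    have "pCons a f = [:a:] + monom 1 1 * f" by (simp add: monom_Suc)
    then have "pCons a f ^ r = ([:a:] + monom 1 1 * f) ^ (p ^ j)" by (simp only: r)
    also have "\<dots> = [:a:] ^ r + (monom 1 1 * f) ^ r" by (simp only: frob_add_poly r)
    also have "\<dots> = [:a ^ r:] + monom 1 r * f ^ r"
      by (simp only: power_mult_distrib monom_power poly_const_pow power_one mult_1_left)
    finally have "phi_act q 1 carlitz_coeff (pCons a f ^ r) (y ^ r) =
        a ^ r * y ^ r + phi_act q 1 carlitz_coeff (f ^ r) ((?C ^^ r) (y ^ r))"
      by (simp only: phi_act_plus phi_act_monom_mult) (simp add: phi_act_pCons phi_act_0)
    also have "\<dots> = (a * y) ^ r + phi_act q r (twisted_power_coeff \<theta> r) f ((?L ^^ r) y) ^ r"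
      by (simp only: pCons.IH iter power_mult_distrib)
    also have "\<dots> = phi_act q r (twisted_power_coeff \<theta> r) (pCons a f) y ^ r"
      by (simp only: phi_act_pCons phi_t_twisted_power) (simp only: r frob_add)
    finally show ?case by simp
  qed
qed

section \<open>Counting polynomials over F_q\<close>

lemma card_Fq: "card (Fq q :: 'a set) = q"
proof -
  let ?f = "monom 1 q - monom 1 1 :: 'a poly"
  have "degree ?f = degree (monom 1 q + - monom 1 1 :: 'a poly)" by simp
  also have "\<dots> = degree (monom 1 q :: 'a poly)"
    by (rule degree_add_eq_left) (use q_gt_1 in \<open>simp add: degree_monom_eq\<close>)
  finally have deg: "degree ?f = q" by (simp add: degree_monom_eq)
  have "CHAR('a) dvd q" using e_pos by (simp add: CHAR_p q_eq)
  then have "(of_nat q :: 'a) = 0" by (simp add: of_nat_eq_0_iff_char_dvd)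
  then have "pderiv ?f = [:-1:]" by (simp add: pderiv_diff pderiv_monom monom_0)
  moreover have "?f \<noteq> 0" using deg q_gt_1 by auto
  ultimately have "card {z. poly ?f z = 0} = q" using card_roots_simple[of ?f] deg by simp
  moreover have "{z. poly ?f z = 0} = Fq q" by (auto simp: Fq_def poly_monom)
  ultimately show ?thesis by simp
qed

text \<open>The bound is on coefficients instead of the degree, so that d = 0 describes {0} and can
  start the induction.\<close>

lemma card_Fq_polys: "card {f :: 'a poly \<in> over (Fq q). \<forall>i\<ge>d. coeff f i = 0} = q ^ d"
proof (induction d)
  case 0
  have "{f :: 'a poly \<in> over (Fq q). \<forall>i\<ge>0. coeff f i = 0} = {0}"
    by (auto simp: over_0[OF subfield_Fq] intro: poly_eqI)
  then show ?case by simp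
next
  case (Suc d)
  let ?D = "\<lambda>d. {f :: 'a poly \<in> over (Fq q). \<forall>i\<ge>d. coeff f i = 0}"
  have "?D (Suc d) = (\<lambda>(a, f). pCons a f) ` (Fq q \<times> ?D d)"
  proof (intro equalityI subsetI)
    fix f assume f: "f \<in> ?D (Suc d)"
    obtain a g where fg: "f = pCons a g" by (cases f)
    have "coeff g i = 0" if "d \<le> i" for i
    proof -
      have "coeff f (Suc i) = 0" using f that by blast
      then show ?thesis by (simp add: fg)
    qed
    then have "(a, g) \<in> Fq q \<times> ?D d" using f fg by (auto simp: over_pCons[OF subfield_Fq])
    then show "f \<in> (\<lambda>(a, f). pCons a f) ` (Fq q \<times> ?D d)" using fg by force
  next
    fix f assume "f \<in> (\<lambda>(a, f). pCons a f) ` (Fq q \<times> ?D d)"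
    then obtain a g where "f = pCons a g" "a \<in> Fq q" "g \<in> ?D d" by auto
    then show "f \<in> ?D (Suc d)"
      by (auto simp: over_pCons[OF subfield_Fq] coeff_pCons split: nat.split)
  qed
  moreover have "inj_on (\<lambda>(a, f). pCons a f) (Fq q \<times> ?D d)" by (auto simp: inj_on_def)
  ultimately show ?case
    using Suc by (simp add: card_image card_cartesian_product card_Fq)
qed

end

section \<open>Carlitz torsion and the Galois action\<close>

context function_field
begin

section \<open>The residue field of a monic irreducible polynomial\<close>

lemma monic_irreducible_bezout:
  assumes \<pi>: "monic_irreducible_A q \<pi>" and f: "f \<in> over (Fq q)" and nd: "\<And>h. h \<in> over (Fq q) \<Longrightarrow> (f :: 'a poly) \<noteq> h * \<pi>"
  obtains u v where "u \<in> over (Fq q)" "v \<in> over (Fq q)" "u * f + v * \<pi> = 1"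
proof -
  note A = subfield_Fq
  have \<pi>A: "\<pi> \<in> over (Fq q)" and \<pi>0: "\<pi> \<noteq> 0"
    and irr: "\<And>a b. a \<in> over (Fq q) \<Longrightarrow> b \<in> over (Fq q) \<Longrightarrow> \<pi> = a * b \<Longrightarrow> degree a = 0 \<or> degree b = 0"
    using \<pi> by (auto simp: monic_irreducible_A_def polyA_eq)
  obtain u v d h k where uv: "u \<in> over (Fq q)" "v \<in> over (Fq q)" and dhk: "d \<in> over (Fq q)"
    "h \<in> over (Fq q)" "k \<in> over (Fq q)" and d: "d = u * \<pi> + v * f" "d \<noteq> 0" "\<pi> = h * d" "f = k * d"
    using that by (rule over_bezout[OF A \<pi>A f \<pi>0])
  \<comment> \<open>A constant \<open>h\<close> would make \<pi> an associate of \<open>d\<close>,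
    hence a divisor of \<open>f\<close>.\<close>
  have "degree h \<noteq> 0"
  proof
    assume "degree h = 0"
    then obtain c where c: "h = [:c:]" by (rule degree_eq_zeroE)
    then have "c \<noteq> 0" using d(3) \<pi>0 by auto
    have cF: "c \<in> Fq q" using dhk(2) c over_const[OF A] by blast
    have "f = smult (inverse c) k * \<pi>" using d(3,4) c \<open>c \<noteq> 0\<close> by simp
    moreover have "smult (inverse c) k \<in> over (Fq q)"
      using over_smult[OF A is_subfieldD(6)[OF A cF] dhk(3)] .
    ultimately show False using nd by blast
  qed
  then have "degree d = 0" using irr[OF dhk(2,1) d(3)] by simp
  then obtain c where c: "d = [:c:]" by (rule degree_eq_zeroE)
  then have "c \<noteq> 0" using d(2) by auto
  have cF: "inverse c \<in> Fq q" using dhk(1) c over_const[OF A] is_subfieldD(6)[OF A] by blast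
  have "smult (inverse c) v * f + smult (inverse c) u * \<pi> = smult (inverse c) d"
    unfolding d(1) by (simp add: smult_add_right)
  also have "\<dots> = 1" using \<open>c \<noteq> 0\<close> by (simp add: c)
  finally show ?thesis using that over_smult[OF A cF] uv by blast
qed

text \<open>Evaluation at a root of \<pi> has kernel generated by \<pi>, so its image is a model of
  F_\<pi> inside the ambient field.\<close>

lemma monic_irreducible_root:
  fixes \<pi> :: "'a poly"
  assumes \<pi>: "monic_irreducible_A q \<pi>"
  obtains z :: 'a where "\<And>f. f \<in> over (Fq q) \<Longrightarrow> poly f z = 0 \<longleftrightarrow> (\<exists>h\<in>over (Fq q). f = h * \<pi>)"
proof -
  have "0 < degree \<pi>" using \<pi> by (simp add: monic_irreducible_A_def)
  then obtain z where z: "poly \<pi> z = 0" using closed unfolding alg_closed_def by blast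
  have "\<exists>h\<in>over (Fq q). f = h * \<pi>" if f: "f \<in> over (Fq q)" "poly f z = 0" for f
  proof (rule ccontr)
    assume *: "\<not> ?thesis"
    obtain u v where "u * f + v * \<pi> = 1"
      by (rule monic_irreducible_bezout[OF \<pi> f(1)]) (use * in blast)
    then have "poly (u * f + v * \<pi>) z = 1" by simp
    then show False using z f by simp
  qed
  then show ?thesis using that[of z] z by (metis mult_zero_right poly_mult)
qed

lemma polys_below_degree_eq:
  assumes "0 < d"
  shows "{f \<in> over (Fq q). \<forall>i\<ge>d. coeff f i = 0} = {f :: 'a poly \<in> over (Fq q). degree f < d}"
  using assms by (auto simp: coeff_eq_0 intro: le_less_trans[OF degree_le[of "d - 1"]])

text \<open>In the model of F_\<pi> given by values at a root of \<pi>, multiplication by u \<noteq>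
  0 permutes the nonzero elements. Comparing products gives u^(q_\<pi> - 1) = 1, so exponents count
  modulo q_\<pi> - 1.\<close>

lemma monic_irreducible_fermat:
  assumes \<pi>: "monic_irreducible_A q \<pi>" and f: "f \<in> over (Fq q)" and nd: "\<And>h. h \<in> over (Fq q) \<Longrightarrow> (f :: 'a poly) \<noteq> h * \<pi>"
    and mn: "[m = n] (mod (q_pi q \<pi> - 1))"
  obtains h where "h \<in> over (Fq q)" "f ^ m - f ^ n = h * \<pi>"
proof -
  note A = subfield_Fq
  define d where "d = degree \<pi>"
  have d: "0 < d" and \<pi>A: "\<pi> \<in> over (Fq q)" and \<pi>0: "\<pi> \<noteq> 0"
    using \<pi> by (auto simp: monic_irreducible_A_def d_def polyA_eq)
  obtain z :: 'a where z: "\<And>f. f \<in> over (Fq q) \<Longrightarrow> poly f z = 0 \<longleftrightarrow> (\<exists>h\<in>over (Fq q). f = h * \<pi>)"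
    using that by (rule monic_irreducible_root[OF \<pi>])
  define D where "D = {f :: 'a poly \<in> over (Fq q). degree f < d}"
  have cD: "card D = q ^ d"
    using card_Fq_polys[of d] by (simp add: D_def polys_below_degree_eq[OF d])
  define E where "E = {poly f z | f. f \<in> over (Fq q)}"
  \<comment> \<open>Remainders of degree below \<open>d\<close> represent the residue classes, which
    yields the size of \<open>E\<close>.\<close>
  have ED: "E = (\<lambda>f. poly f z) ` D"
  proof (intro equalityI subsetI)
    fix x assume "x \<in> E"
    then obtain g where g: "g \<in> over (Fq q)" "x = poly g z" by (auto simp: E_def)
    obtain u v where uv: "u \<in> over (Fq q)" "v \<in> over (Fq q)" "g = u * \<pi> + v" "v = 0 \<or> degree v < d"
      using over_division[OF A g(1) \<pi>A \<pi>0] by (auto simp: d_def)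
    have "poly \<pi> z = 0" using z[OF \<pi>A] over_1[OF A] by auto
    then have "x = poly v z" using g uv by simp
    moreover have "v \<in> D" using uv d by (auto simp: D_def)
    ultimately show "x \<in> (\<lambda>f. poly f z) ` D" by blast
  qed (auto simp: D_def E_def)
  have "inj_on (\<lambda>f. poly f z) D"
  proof (rule inj_onI)
    fix g h assume gh: "g \<in> D" "h \<in> D" "poly g z = poly h z"
    then have "g - h \<in> over (Fq q)" "poly (g - h) z = 0" by (auto simp: D_def over_diff[OF A])
    then obtain k where k: "g - h = k * \<pi>" using z by blast
    have "degree (g - h) < d" using gh by (auto simp: D_def intro: degree_diff_less)
    then have "k = 0" using k \<pi>0 d_def degree_mult_eq by (metis not_add_less2)
    with k show "g = h" by simp
  qed
  then have cE: "card E = q ^ d" using ED cD by (simp add: card_image)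
  then have finE: "finite E" using q_gt_1 by (metis card.infinite not_less_zero power_eq_0_iff gr_implies_not0)
  have "0 \<in> E" using over_0[OF A] by (force simp: E_def)
  define E' where "E' = E - {0}"
  have cE': "card E' = q ^ d - 1" using \<open>0 \<in> E\<close> finE cE by (simp add: E'_def)
  define u where "u = poly f z"
  have u: "u \<noteq> 0" "u \<in> E" using z[OF f] nd f by (auto simp: u_def E_def)
  have "(\<lambda>x. u * x) ` E' \<subseteq> E'"
  proof
    fix y assume "y \<in> (\<lambda>x. u * x) ` E'"
    then obtain g where g: "g \<in> over (Fq q)" "y = u * poly g z" "y \<noteq> 0" using u by (auto simp: E'_def E_def)
    then have "y = poly (f * g) z" by (simp add: u_def)
    then have "y \<in> E" unfolding E_def using over_mult[OF A f g(1)] by blast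
    then show "y \<in> E'" using g(3) by (simp add: E'_def)
  qed
  moreover have inj: "inj_on (\<lambda>x. u * x) E'" using u by (auto simp: inj_on_def)
  ultimately have im: "(\<lambda>x. u * x) ` E' = E'"
    using finE by (intro endo_inj_surj) (auto simp: E'_def)
  have "\<Prod>E' = (\<Prod>x\<in>E'. u * x)" using prod.reindex[OF inj, of "\<lambda>x. x"] im by simp
  also have "\<dots> = u ^ card E' * \<Prod>E'" by (simp add: prod.distrib)
  finally have "u ^ card E' * \<Prod>E' = 1 * \<Prod>E'" by simp
  moreover have "\<Prod>E' \<noteq> 0" using finE by (simp add: E'_def)
  ultimately have u1: "u ^ (q ^ d - 1) = 1" using cE' by simp
  have umod: "u ^ i = u ^ (i mod (q ^ d - 1))" for i
  proof -
    have "u ^ i = u ^ ((q ^ d - 1) * (i div (q ^ d - 1)) + i mod (q ^ d - 1))" by simp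
    also have "\<dots> = (u ^ (q ^ d - 1)) ^ (i div (q ^ d - 1)) * u ^ (i mod (q ^ d - 1))"
      by (simp only: power_add power_mult)
    finally show ?thesis by (simp only: u1 power_one mult_1_left)
  qed
  have "u ^ m = u ^ n"
    using umod[of m] umod[of n] mn by (simp add: cong_def q_pi_def d_def)
  then have "poly (f ^ m - f ^ n) z = 0" by (simp add: u_def)
  then show ?thesis
    using z[of "f ^ m - f ^ n"] over_diff[OF A over_power[OF A f] over_power[OF A f]] that by blast
qed

text \<open>C[\<pi>] is a line over F_\<pi>, so any nonzero point generates it. If C_g \<mu> = C_h
  \<mu> for distinct g, h of degree below d, a Bezout relation between g - h and \<pi> would kill
  \<mu>. Hence the q^d remainders give q^d points, which is all of C[\<pi>].\<close>

lemma carlitz_torsion_generator: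
  assumes \<pi>: "monic_irreducible_A q \<pi>"
  obtains \<mu> :: 'a where "\<mu> \<noteq> 0" "carlitz_act q t \<pi> \<mu> = 0"
    "\<And>y. carlitz_act q t \<pi> y = 0 \<Longrightarrow> \<exists>f\<in>over (Fq q). y = carlitz_act q t f \<mu>"
proof -
  note A = subfield_Fq
  let ?C = "\<lambda>f x. carlitz_act q t f (x :: 'a)"
  note C_rules = phi_act_mult[where r = 1 and c = carlitz_coeff, folded carlitz_act_def]
    phi_act_plus[where r = 1 and c = carlitz_coeff, folded carlitz_act_def]
    phi_act_minus[where r = 1 and c = carlitz_coeff, folded carlitz_act_def]
    phi_act_zero[where r = 1 and c = carlitz_coeff, folded carlitz_act_def]
    phi_act_1[where r = 1 and c = carlitz_coeff, folded carlitz_act_def]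
  define d where "d = degree \<pi>"
  have d: "0 < d" and \<pi>A: "\<pi> \<in> over (Fq q)" and \<pi>0: "\<pi> \<noteq> 0"
    using \<pi> by (auto simp: monic_irreducible_A_def d_def polyA_eq)
  have \<pi>t: "poly \<pi> t \<noteq> 0" using transcendental \<pi>A \<pi>0 by blast
  define T where "T = {y. ?C \<pi> y = 0}"
  have cT: "card T = q ^ d"
    using card_phi_kernel[of carlitz_coeff 1 \<pi>] \<pi>t by (simp add: T_def carlitz_act_def d_def)
  have "1 < card T" using one_less_power[OF q_gt_1 d] by (simp only: cT)
  then have finT: "finite T" by (metis card.infinite not_one_less_zero)
  have "\<not> T \<subseteq> {0}"
  proof
    assume "T \<subseteq> {0}"
    then have "card T \<le> card {0 :: 'a}" by (intro card_mono) auto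
    with \<open>1 < card T\<close> show False by simp
  qed
  then obtain \<mu> where \<mu>: "\<mu> \<noteq> 0" "?C \<pi> \<mu> = 0" by (auto simp: T_def)
  define D where "D = {f :: 'a poly \<in> over (Fq q). degree f < d}"
  have cD: "card D = q ^ d"
    using card_Fq_polys[of d] by (simp add: D_def polys_below_degree_eq[OF d])
  have "inj_on (\<lambda>f. ?C f \<mu>) D"
  proof (rule inj_onI)
    fix g h assume gh: "g \<in> D" "h \<in> D" "?C g \<mu> = ?C h \<mu>"
    then have ghA: "g - h \<in> over (Fq q)" and z: "?C (g - h) \<mu> = 0"
      by (auto simp: D_def over_diff[OF A] C_rules)
    have dg: "degree (g - h) < d" using gh by (auto simp: D_def intro: degree_diff_less)
    show "g = h"
    proof (rule ccontr)
      assume "g \<noteq> h"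
      then have nd: "g - h \<noteq> k * \<pi>" for k
        using dg \<pi>0 degree_mult_eq[of k \<pi>] by (cases "k = 0") (auto simp: d_def)
      obtain u v where uv: "u \<in> over (Fq q)" "v \<in> over (Fq q)" "u * (g - h) + v * \<pi> = 1"
        using that nd by (rule monic_irreducible_bezout[OF \<pi> ghA, rotated])
      have "\<mu> = ?C (u * (g - h) + v * \<pi>) \<mu>" unfolding uv(3) by (simp add: C_rules)
      also have "\<dots> = ?C (u * (g - h)) \<mu> + ?C (v * \<pi>) \<mu>" by (rule C_rules)
      also have "\<dots> = ?C u (?C (g - h) \<mu>) + ?C v (?C \<pi> \<mu>)"
        using uv ghA \<pi>A by (simp only: C_rules)
      also have "\<dots> = 0" by (simp add: z \<mu>(2) C_rules(4))
      finally show False using \<mu>(1) by simp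
    qed
  qed
  then have "card ((\<lambda>f. ?C f \<mu>) ` D) = card T" using cD cT by (simp add: card_image)
  moreover have "(\<lambda>f. ?C f \<mu>) ` D \<subseteq> T"
  proof
    fix y assume "y \<in> (\<lambda>f. ?C f \<mu>) ` D"
    then obtain f where f: "f \<in> over (Fq q)" "y = ?C f \<mu>" by (auto simp: D_def)
    have "?C \<pi> y = ?C (f * \<pi>) \<mu>" using f \<pi>A by (simp add: C_rules(1)[symmetric] mult.commute)
    also have "\<dots> = ?C f (?C \<pi> \<mu>)" using f \<pi>A by (simp only: C_rules)
    also have "\<dots> = 0" by (simp add: \<mu>(2) C_rules(4))
    finally show "y \<in> T" by (simp add: T_def)
  qed
  ultimately have "T = (\<lambda>f. ?C f \<mu>) ` D" using finT by (metis card_subset_eq)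
  then have "\<exists>f\<in>over (Fq q). y = ?C f \<mu>" if "?C \<pi> y = 0" for y
    using that by (auto simp: T_def D_def)
  then show ?thesis using that \<mu> by blast
qed

end

context function_field_ext
begin

text \<open>\<sigma> respects sums and products only on the separable closure, so every intermediate
  value of the Horner scheme must be separable. These values lie in K[y], where
  \<open>separable_adj\<close> applies.\<close>

lemma galois_poly:
  assumes \<sigma>: "\<sigma> \<in> abs_galois K" and y: "separable_over K y" and f: "f \<in> over K"
  shows "\<sigma> (poly f y) = poly f (\<sigma> y)"
proof -
  note K = subfield_K
  have add: "\<sigma> (a + b) = \<sigma> a + \<sigma> b" and mult: "\<sigma> (a * b) = \<sigma> a * \<sigma> b"
    if "a \<in> adj K y" "b \<in> adj K y" for a b
    using \<sigma> that separable_adj[OF K y] by (auto simp: abs_galois_def sep_closure_def)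
  have fixK: "\<sigma> a = a" if "a \<in> K" for a using \<sigma> that by (auto simp: abs_galois_def)
  show ?thesis using f
  proof (induction f)
    case 0
    show ?case using fixK is_subfieldD(1)[OF K] by simp
  next
    case (pCons a f)
    have af: "a \<in> K" "f \<in> over K" using pCons.prems over_pCons[OF K] by auto
    have "poly f y \<in> adj K y" using af by (auto simp: adj_def)
    moreover have "y * poly f y = poly (pCons 0 f) y" by simp
    then have "y * poly f y \<in> adj K y"
      unfolding adj_def using af is_subfieldD(1)[OF K] over_pCons[OF K] by blast
    ultimately show ?case
      using pCons.IH af by (simp add: add mult fixK adj_base[OF K] adj_gen[OF K])
  qed
qed

lemma galois_phi_act:
  assumes \<sigma>: "\<sigma> \<in> abs_galois K" and y: "separable_over K y" and f: "f \<in> over (Fq q)"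
    and c: "\<And>i. i \<le> r \<Longrightarrow> c i \<in> K" "c r \<noteq> 0" "0 < r"
  shows "\<sigma> (phi_act q r c f y) = phi_act q r c f (\<sigma> y)"
proof -
  have "Fq q \<subseteq> K" using Fq_ratfield ratfield_K by blast
  then have "f \<in> over K" using f over_mono by blast
  then obtain P where P: "P \<in> over K" "\<And>x. poly P x = phi_act q r c f x"
    using phi_act_poly[where r = r and c = c, OF subfield_K c] by blast
  then show ?thesis using galois_poly[OF \<sigma> y P(1)] by simp
qed

lemma t_in_K: "t \<in> K" and Fq_in_K: "Fq q \<subseteq> K"
  using t_ratfield Fq_ratfield ratfield_K by auto

text \<open>The Carlitz module in the r-th power of the variable governs the Drinfeld module, so its
  filtration by powers of \<pi> is pulled back along the Frobenius; r i = 1 modulo q_\<pi> - 1 turns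
  the action of a^r on graded pieces back into that of a.\<close>
lemma twisted_power_D2:
  assumes \<pi>: "monic_irreducible_A q \<pi>" and r: "r = p ^ j" and \<theta>: "\<theta> \<in> K" "\<theta> ^ r = t"
  shows "cond_D2 q t K r (twisted_power_coeff \<theta> r) \<pi>"
proof -
  note A = subfield_Fq
  note K = subfield_K
  let ?c = "twisted_power_coeff \<theta> r"
  let ?C = "\<lambda>f x. carlitz_act q t f (x :: 'a)"
  let ?phi = "phi_act q r ?c"
  have r0: "0 < r" using r p_pos by simp
  have cK: "?c i \<in> K" for i
    using \<theta>(1) is_subfieldD[OF K] by (intro twisted_power_coeff_closed) auto
  have cr: "?c r \<noteq> 0" by (simp add: twisted_power_coeff_simps)
  have c0: "?c 0 = t" by (simp add: twisted_power_coeff_simps \<theta>)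
  note C_mult = phi_act_mult[where r = 1 and c = carlitz_coeff, folded carlitz_act_def]
  note C_minus = phi_act_minus[where r = 1 and c = carlitz_coeff, folded carlitz_act_def]
  note C_add = phi_act_add[where r = 1 and c = carlitz_coeff, folded carlitz_act_def]
  note C_diff = phi_act_diff[where r = 1 and c = carlitz_coeff, folded carlitz_act_def]
  note C_zero = phi_act_zero[where r = 1 and c = carlitz_coeff, folded carlitz_act_def]
  note C_one = phi_act_1[where r = 1 and c = carlitz_coeff, folded carlitz_act_def]
  have C_comm: "?C f (?C g x) = ?C g (?C f x)" if "f \<in> over (Fq q)" "g \<in> over (Fq q)" for f g x
    using that by (simp add: C_mult[symmetric] mult.commute)
  have phi_C: "?phi f y ^ r = ?C (f ^ r) (y ^ r)" for f y by (rule phi_act_twisted_power[OF r \<theta>(2)])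
  have \<pi>A: "\<pi> \<in> over (Fq q)" and \<pi>0: "\<pi> \<noteq> 0" and d0: "0 < degree \<pi>"
    using \<pi> by (auto simp: monic_irreducible_A_def polyA_eq)
  have \<pi>sA: "\<pi> ^ s \<in> over (Fq q)" for s by (rule over_power[OF A \<pi>A])
  have \<pi>t: "poly \<pi> t \<noteq> 0" using transcendental \<pi>A \<pi>0 by blast
  have FqK: "f \<in> over K" if "f \<in> over (Fq q)" for f using that Fq_in_K over_mono by blast
  have ccK: "carlitz_coeff i \<in> K" for i using t_in_K is_subfieldD(2)[OF K] by simp
  have sepC: "separable_over M y" if "?C \<pi> y = 0" "is_subfield M" "ratfield q t \<subseteq> M" for y M
  proof -
    have "Fq q \<subseteq> M" "t \<in> M" using that Fq_ratfield t_ratfield by blast+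
    then show ?thesis
      using that \<pi>t over_mono[OF _ \<pi>A, of M] is_subfieldD(2)[OF that(2)]
      by (intro separable_phi_kernel[of M 1 carlitz_coeff \<pi> y]) (auto simp: carlitz_act_def)
  qed
  \<comment> \<open>The preimage of C[\<pi>^s] under r-th powers. At s = r it becomes \<phi>[\<pi>],
    because \<phi>_\<pi>(y)^r = C_{\<pi>^r}(y^r).\<close>
  define V where "V s = {y. ?C (\<pi> ^ s) (y ^ r) = 0}" for s
  \<comment> \<open>r-th powering is an iterate of the p-power Frobenius, bijective on the ambient
    field, so the size of C[\<pi>^s] carries over to \<open>V s\<close>.\<close>
  have bij: "bij (\<lambda>y :: 'a. y ^ r)"
    unfolding bij_def inj_def surj_def r using frob_eq_iff frob_root_exists by metis
  have cardV: "card (V s) = q_pi q \<pi> ^ s" for s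
  proof -
    have "V s = (\<lambda>y. y ^ r) -` {y. ?C (\<pi> ^ s) y = 0}" by (auto simp: V_def)
    then have "card (V s) = card {y. ?C (\<pi> ^ s) y = 0}"
      using card_vimage_inj[OF bij_is_inj[OF bij], of "{y. ?C (\<pi> ^ s) y = 0}"] bij_is_surj[OF bij]
      by (metis subset_UNIV)
    also have "\<dots> = q ^ degree (\<pi> ^ s)"
      using card_phi_kernel[of carlitz_coeff 1 "\<pi> ^ s"] \<pi>t by (simp add: carlitz_act_def)
    also have "\<dots> = q_pi q \<pi> ^ s"
      by (simp add: q_pi_def degree_power_eq[OF \<pi>0] mult.commute flip: power_mult)
    finally show ?thesis .
  qed
  have Vmono: "V s \<subseteq> V s'" if "s \<le> s'" for s s'
  proof
    fix y assume y: "y \<in> V s"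
    have "\<pi> ^ s' = \<pi> ^ (s' - s) * \<pi> ^ s" using that by (simp flip: power_add)
    then show "y \<in> V s'" using y \<pi>sA by (simp add: V_def C_mult C_zero)
  qed
  have Vphi: "y \<in> V r \<longleftrightarrow> ?phi \<pi> y = 0" for y
    using phi_C[of \<pi> y] r0 by (simp add: V_def) (metis power_eq_0_iff r0)
  \<comment> \<open>Extracting r-th roots might leave the separable closure. It does not, because
    \<open>V s\<close> lies in the kernel of \<phi>_\<pi>, which is given by a separable polynomial
    over \<open>K\<close>.\<close>
  have sepV: "separable_over K y" if "y \<in> V s" "s \<le> r" for y s
  proof -
    have "?phi \<pi> y = 0" using Vphi Vmono that by blast
    then show ?thesis
      using separable_phi_kernel[of K r ?c \<pi> y] K cK cr r0 FqK[OF \<pi>A] \<pi>t c0 by simp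
  qed
  have Vr: "V r = dm_torsion q K r ?c \<pi>"
    using Vphi sepV[of _ r] by (auto simp: dm_torsion_def sep_closure_def)
  have V0: "V 0 = {0}" using r0 by (auto simp: V_def C_one)
  have Vadd: "x + y \<in> V s" if "x \<in> V s" "y \<in> V s" for x y s
    using that by (simp add: V_def r frob_add C_add)
  have Vact: "?phi a x \<in> V s" if "a \<in> over (Fq q)" "x \<in> V s" for a x s
    using that C_comm[OF \<pi>sA over_power[OF A that(1)]] by (simp add: V_def phi_C C_zero)
  have pow_sep: "separable_over K (y ^ r)" "\<sigma> (y ^ r) = \<sigma> y ^ r"
    if "separable_over K y" "\<sigma> \<in> abs_galois K" for y \<sigma>
  proof -
    have m: "monom 1 r \<in> over K" "poly (monom 1 r) x = x ^ r" for x :: 'a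
      using is_subfieldD(2)[OF K] by (auto simp: over_monom[OF K] poly_monom)
    have "y ^ r \<in> adj K y" unfolding adj_def using m by (metis (mono_tags, lifting) mem_Collect_eq)
    then show "separable_over K (y ^ r)" by (rule separable_adj[OF K that(1)])
    show "\<sigma> (y ^ r) = \<sigma> y ^ r" using galois_poly[OF that(2,1) m(1)] by (simp add: m(2))
  qed
  have \<sigma>C: "\<sigma> (?C f y) = ?C f (\<sigma> y)"
    if "separable_over K y" "\<sigma> \<in> abs_galois K" "f \<in> over (Fq q)" for f y \<sigma>
    unfolding carlitz_act_def using that ccK by (intro galois_phi_act) auto
  have \<sigma>0: "\<sigma> 0 = 0" if "\<sigma> \<in> abs_galois K" for \<sigma>
    using that is_subfieldD(1)[OF K] by (auto simp: abs_galois_def)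
  have V\<sigma>: "\<sigma> y \<in> V s" if "\<sigma> \<in> abs_galois K" "y \<in> V s" "s \<le> r" for \<sigma> y s
  proof -
    have y: "separable_over K y" using sepV that by blast
    have "?C (\<pi> ^ s) (\<sigma> y ^ r) = \<sigma> (?C (\<pi> ^ s) (y ^ r))"
      using pow_sep[OF y that(1)] \<sigma>C[OF _ that(1) \<pi>sA] by simp
    then show ?thesis using that \<sigma>0 by (simp add: V_def)
  qed
  obtain \<mu> where \<mu>: "\<mu> \<noteq> 0" "?C \<pi> \<mu> = 0" "\<And>y. ?C \<pi> y = 0 \<Longrightarrow> \<exists>f\<in>over (Fq q). y = ?C f \<mu>"
    using that by (rule carlitz_torsion_generator[OF \<pi>])
  have \<mu>sep: "separable_over K \<mu>" using sepC[OF \<mu>(2) K ratfield_K] .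
  define N where "N = q_pi q \<pi> - 1"
  have N: "0 < N" using q_gt_1 d0 one_less_power[of q "degree \<pi>"] by (simp add: N_def q_pi_def)
  \<comment> \<open>r and q_\<pi> are both powers of p, and N = q_\<pi> - 1.\<close>
  have "coprime r N"
  proof -
    have "coprime (q ^ degree \<pi>) N"
      unfolding N_def q_pi_def by (rule coprime_diff_one_right_nat) (use q_gt_1 in simp)
    moreover have "p dvd q ^ degree \<pi>" using d0 e_pos by (simp add: q_eq flip: power_mult)
    ultimately have "coprime p N" using coprime_divisors dvd_refl by blast
    then show ?thesis by (simp add: r)
  qed
  then obtain i0 where i0: "[r * i0 = 1] (mod N)" using cong_solve_coprime_nat by auto
  define i where "i = i0 mod N"
  have iN: "i \<le> N" using N by (simp add: i_def less_imp_le)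
  have ri: "[i * r = 1] (mod N)"
    using i0 by (simp add: i_def cong_def mult.commute mod_mult_right_eq)
  have char: "\<exists>b. carlitz_char_rep q t \<pi> \<sigma> b \<and>
      (\<forall>x\<in>V s. \<sigma> x - ?phi (b ^ i) x \<in> V (s - 1))" if \<sigma>: "\<sigma> \<in> abs_galois K" and s: "s \<in> {1..r}" for \<sigma> s
  proof -
    have "?C \<pi> (\<sigma> \<mu>) = 0" using \<sigma>C[OF \<mu>sep \<sigma> \<pi>A] \<mu>(2) \<sigma>0[OF \<sigma>] by simp
    \<comment> \<open>\<open>b\<close> represents \<chi>_\<pi>(\<sigma>): its value on the generator
      \<mu> determines the action on all of C[\<pi>].\<close>
    then obtain b where b: "b \<in> over (Fq q)" "\<sigma> \<mu> = ?C b \<mu>" using \<mu>(3) by blast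
    have act: "\<sigma> y = ?C b y" if y: "?C \<pi> y = 0" for y
    proof -
      obtain f where f: "f \<in> over (Fq q)" "y = ?C f \<mu>" using \<mu>(3)[OF y] by blast
      then show ?thesis using \<sigma>C[OF \<mu>sep \<sigma> f(1)] b C_comm by simp
    qed
    \<comment> \<open>Injectivity of \<sigma> makes \<open>b\<close> invertible modulo \<pi>, so
      that its exponents may be reduced modulo \<open>N\<close>.\<close>
    have "\<sigma> \<mu> \<noteq> 0"
    proof
      assume "\<sigma> \<mu> = 0"
      moreover have "separable_over K 0" using separable_adj[OF K \<mu>sep adj_base[OF K]] is_subfieldD(1)[OF K] by blast
      moreover have "inj_on \<sigma> (sep_closure K)" using \<sigma> by (auto simp: abs_galois_def bij_betw_def)
      ultimately show False using \<sigma>0[OF \<sigma>] \<mu>sep \<mu>(1) by (auto simp: sep_closure_def inj_on_def)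
    qed
    then have "b \<noteq> h * \<pi>" if "h \<in> over (Fq q)" for h
      using b(2) that by (auto simp: C_mult[OF that \<pi>A] \<mu>(2) C_zero)
    then obtain h where h: "h \<in> over (Fq q)" "b ^ (i * r) - b ^ 1 = h * \<pi>"
      using monic_irreducible_fermat[OF \<pi> b(1) _ ri[unfolded N_def]] by blast
    have bi: "?C ((b ^ i) ^ r) y = ?C b y" if "?C \<pi> y = 0" for y
    proof -
      have "?C (b ^ (i * r) - b ^ 1) y = ?C h (?C \<pi> y)" unfolding h(2) by (rule C_mult[OF h(1) \<pi>A])
      then show ?thesis using that by (simp add: C_minus C_zero power_mult)
    qed
    have "\<sigma> x - ?phi (b ^ i) x \<in> V (s - 1)" if x: "x \<in> V s" for x
    proof -
      have xs: "separable_over K x" using sepV x s by simp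
      \<comment> \<open>The map from x to \<open>w\<close> embeds V s / V (s - 1) into C[\<pi>].
        There \<sigma> becomes C_b and \<phi>_{b^i} becomes C_{b^(i r)}, which agrees with C_b on
        C[\<pi>].\<close>
      define w where "w = ?C (\<pi> ^ (s - 1)) (x ^ r)"
      have "?C \<pi> w = ?C (\<pi> * \<pi> ^ (s - 1)) (x ^ r)" unfolding w_def using C_mult[OF \<pi>A \<pi>sA] by simp
      also have "\<pi> * \<pi> ^ (s - 1) = \<pi> ^ s" using s by (simp flip: power_Suc)
      finally have w: "?C \<pi> w = 0" using x by (simp add: V_def)
      have "?C (\<pi> ^ (s - 1)) ((\<sigma> x - ?phi (b ^ i) x) ^ r) =
          ?C (\<pi> ^ (s - 1)) (\<sigma> (x ^ r)) - ?C (\<pi> ^ (s - 1)) (?C ((b ^ i) ^ r) (x ^ r))"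
        using pow_sep(2)[OF xs \<sigma>] phi_C[of "b ^ i" x] by (simp add: r frob_diff C_diff)
      also have "\<dots> = \<sigma> w - ?C ((b ^ i) ^ r) w"
        unfolding w_def using \<sigma>C[OF pow_sep(1)[OF xs \<sigma>] \<sigma> \<pi>sA]
          C_comm[OF \<pi>sA over_power[OF A over_power[OF A b(1)]]] by simp
      also have "\<dots> = 0" using act[OF w] bi[OF w] by simp
      finally show ?thesis by (simp add: V_def)
    qed
    moreover have "carlitz_char_rep q t \<pi> \<sigma> b"
      using b(1) act by (auto simp: carlitz_char_rep_def polyA_eq carlitz_torsion_def)
    ultimately show ?thesis by blast
  qed
  show ?thesis
    unfolding cond_D2_def
  \<comment> \<open>All graded pieces carry the same character \<chi>_\<pi>^i, so the exponent
    function is constant; \<open>i\<close> was fixed before \<sigma>.\<close>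
  proof (intro exI[of _ V] exI[of _ "\<lambda>_. i"] conjI ballI allI impI)
    show "V 0 = {0}" "V r = dm_torsion q K r ?c \<pi>" by fact+
    show "V (s - 1) \<subseteq> V s" for s by (rule Vmono) simp
    show "0 \<in> V s" for s using Vmono[of 0 s] V0 by auto
    show "x + y \<in> V s" if "x \<in> V s" "y \<in> V s" for s x y using Vadd that .
    show "?phi a x \<in> V s" if "a \<in> polyA q" "x \<in> V s" for s a x using Vact that by (simp add: polyA_eq)
    show "card (V s) = q_pi q \<pi> ^ s" for s by (rule cardV)
    show "\<sigma> ` V s \<subseteq> V s" if "s \<le> r" "\<sigma> \<in> abs_galois K" for s \<sigma> using V\<sigma> that by blast
    show "i \<le> q_pi q \<pi> - 1" using iN by (simp add: N_def)
    show "\<exists>b. carlitz_char_rep q t \<pi> \<sigma> b \<and> (\<forall>x\<in>V s. \<sigma> x - ?phi (b ^ i) x \<in> V (s - 1))"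
      if "s \<in> {1..r}" "\<sigma> \<in> abs_galois K" for s \<sigma> using char that by blast
  qed
qed

text \<open>From r v(\<theta>) = v(t) \<ge> 0 the element \<theta> is integral at v, hence so are
  all coefficients, and the leading one is 1. The given model is already good, so u = 1 is the
  witness.\<close>

lemma twisted_power_D1:
  assumes r: "0 < r" and \<theta>: "\<theta> \<in> K" "\<theta> ^ r = t"
  shows "cond_D1 q t K r (twisted_power_coeff \<theta> r) \<pi>"
  unfolding cond_D1_def
proof (intro allI impI)
  note K = is_subfieldD[OF subfield_K]
  fix v assume v: "normalized_dval K v \<and> 0 \<le> v t \<and> \<not> 0 < v (poly \<pi> t)"
  then have mult: "v (x * y) = v x + v y" and add: "x + y \<noteq> 0 \<Longrightarrow> min (v x) (v y) \<le> v (x + y)"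
    if "x \<in> K" "x \<noteq> 0" "y \<in> K" "y \<noteq> 0" for x y
    using that by (auto simp: normalized_dval_def)
  have v1: "v 1 = 0" using mult[of 1 1] K(2) by simp
  define R where "R = {x \<in> K. x = 0 \<or> 0 \<le> v x}"
  have "v (\<theta> ^ n) = int n * v \<theta>" if "\<theta> \<noteq> 0" for n
  proof (induction n)
    case (Suc n)
    then show ?case using mult[of \<theta> "\<theta> ^ n"] that \<theta>(1) K(9)[OF \<theta>(1)] by (simp add: algebra_simps)
  qed (simp add: v1)
  then have "v t = int r * v \<theta>" if "\<theta> \<noteq> 0" using that \<theta>(2) by blast
  then have "0 \<le> v \<theta>" if "\<theta> \<noteq> 0" using that v r mult_pos_neg[of "int r" "v \<theta>"] by fastforce
  then have \<theta>R: "\<theta> \<in> R" using \<theta>(1) by (auto simp: R_def)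
  have "twisted_power_coeff \<theta> r i \<in> R" for i
  proof (rule twisted_power_coeff_closed)
    show "x + y \<in> R" if "x \<in> R" "y \<in> R" for x y
    proof (cases "x = 0 \<or> y = 0 \<or> x + y = 0")
      case True
      then show ?thesis using that K(1) by (auto simp: R_def)
    next
      case False
      then show ?thesis using that add[of x y] K(3) by (auto simp: R_def)
    qed
    show "x * y \<in> R" if "x \<in> R" "y \<in> R" for x y
      using that mult[of x y] K(1,5) by (cases "x = 0 \<or> y = 0") (auto simp: R_def)
  qed (use \<theta>R K v1 in \<open>auto simp: R_def\<close>)
  then show "good_reduction_at q K r (twisted_power_coeff \<theta> r) v"
    unfolding good_reduction_at_def using K(2) v1
    by (intro bexI[of _ 1]) (auto simp: R_def twisted_power_coeff_simps)
qed

end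

theorem theorem5p6:
  fixes t :: "'a::field" and K :: "'a set" and p e q r :: nat and \<pi> :: "'a poly"
  assumes "alg_closed TYPE('a)"
    and "prime p" and "CHAR('a) = p"
    and "0 < e" and "q = p ^ e"
    and "transcendental_over_Fq q t"
    and "is_subfield K" and "ratfield q t \<subseteq> K" and "findim_over (ratfield q t) K"
    and "0 < r" and "r dvd insep_degree q t K"
    and "monic_irreducible_A q \<pi>"
  shows "\<exists>c. drinfeld_module q t K r c \<and> cond_D1 q t K r c \<pi> \<and> cond_D2 q t K r c \<pi>"
proof -
  interpret function_field_ext p "TYPE('a)" e q t K
    using assms by unfold_locales auto
  obtain j \<theta> where \<theta>: "r = p ^ j" "\<theta> \<in> K" "\<theta> ^ r = t"
    using that by (rule root_of_t[OF assms(11)])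
  have "twisted_power_coeff \<theta> r i \<in> K" for i
    using \<theta>(2) is_subfieldD[OF subfield_K] by (intro twisted_power_coeff_closed) auto
  then have "drinfeld_module q t K r (twisted_power_coeff \<theta> r)"
    using \<theta>(3) by (simp add: drinfeld_module_def twisted_power_coeff_simps)
  then show ?thesis
    using twisted_power_D1[OF assms(10) \<theta>(2,3)] twisted_power_D2[OF assms(12) \<theta>] by blast
qed

end
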